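(* For every infinite sequence $\mathbf{k}=(k_1,k_2,\ldots)$ of positive integers, the function \[ P_{\mathbf{k}}(z)=\frac{zF_{\mathbf{k}}'(z)}{F_{\mathbf{k}}(z)} \] (with its removable singularity at $0$ filled in) belongs to $\mathfrak{T}$ and is not constant. Hence, for $0<\theta<\pi$, \[ \frac{d}{d\theta}\arg F_{\mathbf{k}}(e^{i\theta})>0,\qquad\frac{d}{d\theta}|F_{\mathbf{k}}(e^{i\theta})|<0. \]
   Context: Let $\Lambda=\mathbb{C}\setminus[1,+\infty)$. $\mathfrak{T}$ is the class of all functions on $\Lambda$ of the form $h(z)=\int_{[0,1]}\frac{d\mu(t)}{1-tz}$ with $\mu$ a Borel probability measure on $[0,1]$. For a finite sequence of positive integers put $A_{k_1,\ldots,k_r}(n)=\frac{1}{(n+1)^{k_1}}\sum_{n+1\geq n_2\geq\cdots\geq n_r\geq 1}\frac{1}{n_2^{k_2}\cdots n_r^{k_r}}$ ($n\ge0$; inner sum $1$ if $r=1$), and for the infinite sequence $\mathbf{k}$ put $A_{\mathbf{k}}(n)=\lim_{r\to\infty}A_{k_1,\ldots,k_r}(n)$ (this limit exists, lies in $(0,1]$, and $A_{\mathbf{k}}(0)=1$). The function $F_{\mathbf{k}}(z)=\sum_{n\ge1}A_{\mathbf{k}}(n)z^n$ ($|z|<1$) extends holomorphically to $\Lambda$; indeed there is a probability measure $\mu_{\mathbf{k}}$ on $[0,1]$ with $A_{\mathbf{k}}(n)=\int t^n\,d\mu_{\mathbf{k}}(t)$ for all $n\ge0$, and $F_{\mathbf{k}}(z)=z\int_{[0,1]}\frac{t\,d\mu_{\mathbf{k}}(t)}{1-tz}$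 on $\Lambda$. The only zero of $F_{\mathbf{k}}$ in $\Lambda$ is a simple zero at $0$. For $0<\theta<\pi$ one has $\mathrm{Im}\,F_{\mathbf{k}}(e^{i\theta})>0$, and $\arg F_{\mathbf{k}}(e^{i\theta})$ denotes the argument in $(0,\pi)$. *)

theory Defs
  imports "HOL-Complex_Analysis.Complex_Analysis" "HOL-Probability.Probability"
begin

definition slit_plane :: "complex set" ("\<Lambda>") where
  "\<Lambda> = UNIV - complex_of_real ` {1..}"

text \<open>
  A function on the slit plane is represented by a total function, of which only the values
  on the slit plane matter.
\<close>

definition class_T :: "(complex \<Rightarrow> complex) set" ("\<TT>") where
  "\<TT> = {h. \<exists>M :: real measure.
      prob_space M \<and> sets M = sets (restrict_space borel {0..1}) \<and>
      (\<forall>z\<in>\<Lambda>. h z = (\<integral>t. 1 / (1 - complex_of_real t * z) \<partial>M))}"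

text \<open>
  Sequences \<open>k\<^sub>1, k\<^sub>2, \<dots>\<close> are functions on the naturals whose value at \<open>0\<close> is never used.
  The summation runs over the tuples \<open>(m\<^sub>2, \<dots>, m\<^sub>r)\<close> with
  \<open>n + 1 \<ge> m\<^sub>2 \<ge> \<dots> \<ge> m\<^sub>r \<ge> 1\<close>; for \<open>r = 1\<close> there is exactly one (empty) tuple, of weight 1.
\<close>

definition A_fin :: "(nat \<Rightarrow> nat) \<Rightarrow> nat \<Rightarrow> nat \<Rightarrow> real" where
  "A_fin k r n = 1 / real (n + 1) ^ k 1 *
     (\<Sum>m\<in>{m \<in> {2..r} \<rightarrow>\<^sub>E {1..n + 1}. \<forall>i\<in>{2..<r}. m (i + 1) \<le> m i}.
        1 / (\<Prod>i\<in>{2..r}. real (m i) ^ k i))"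

definition A_inf :: "(nat \<Rightarrow> nat) \<Rightarrow> nat \<Rightarrow> real" where
  "A_inf k n = lim (\<lambda>r. A_fin k r n)"

text \<open>
  The holomorphic extension to the slit plane of \<open>\<Sum>n\<ge>1. A_inf k n * z ^ n\<close>. By the identity
  theorem its values on the slit plane do not depend on the choice.
\<close>

definition F_ext :: "(nat \<Rightarrow> nat) \<Rightarrow> complex \<Rightarrow> complex" where
  "F_ext k = (SOME f. f holomorphic_on \<Lambda> \<and>
     (\<forall>z. norm z < 1 \<longrightarrow> (\<lambda>n. complex_of_real (A_inf k (Suc n)) * z ^ Suc n) sums f z))"

definition P_fun :: "(nat \<Rightarrow> nat) \<Rightarrow> complex \<Rightarrow> complex" where
  "P_fun k z =
     (let Q = (\<lambda>w. w * deriv (F_ext k) w / F_ext k w) in if z = 0 then Lim (at 0) Q else Q z)"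

end

theory Submission
  imports Defs "HOL-Real_Asymp.Real_Asymp"
begin

text \<open>
  If \<open>z F' / F\<close> is to be the transform of a probability measure \<open>M\<close>, the coefficients
  \<open>b\<^sub>n = A\<^sub>k (n + 1)\<close> of \<open>F z / z\<close> have to satisfy \<open>n b\<^sub>n = (\<Sum>j=1..n. c\<^sub>j b\<^bsub>n-j\<^esub>)\<close> with \<open>c\<^sub>j\<close> the moments
  of \<open>M\<close>; conversely, \<open>F\<close> is recovered from \<open>M\<close> as \<open>b\<^sub>0 z exp E\<close>, where \<open>E 0 = 0\<close> and
  \<open>E' z = (\<integral>t. t / (1 - t z) \<partial>M)\<close>. The recurrence is stable under limits, since the probability measures on
  \<open>[0,1]\<close> are compact.

  The finite sums \<open>A_fin k r n\<close> are the moments of a density \<open>\<phi>\<close> on \<open>[0,1]\<close> obtained from the constant \<open>1\<close>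
  by iterating \<open>\<phi> \<mapsto> (\<integral> t in u..1. \<phi> t / t)\<close> and \<open>\<phi> \<mapsto> (\<integral> t in 0..u. \<phi> t / (1 - t))\<close>. In the coordinate
  \<open>y = ln (t / (1 - t))\<close> these are tail integrals against log-concave weights, so that \<open>\<phi>\<close> is a log-concave
  function of \<open>y\<close>.

  Discretising \<open>\<phi>\<close> on a uniform grid in \<open>y\<close> turns \<open>F z / z\<close> into a partial fraction whose zeros interlace with
  its poles. By log-concavity the relative position of a zero between the neighbouring poles is monotone along
  the grid, and this monotonicity becomes positivity of the logarithmic derivative as the mesh tends to \<open>0\<close>.
\<close>

section \<open>Probability measures on the unit interval\<close>

text \<open>The logistic coordinate is dictated by the kernel: if \<open>exp u = z / (1 - z)\<close>
  and \<open>exp y = t / (1 - t)\<close>, then \<open>(1 - t) / (z - t)\<close> is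
  \<open>1 / (exp u - exp y)\<close> up to a factor depending on \<open>z\<close> alone, and a
  translation of the grid only rescales the latter. The equations for two consecutive zeros thus
  differ by a shift of the weights, and log-concavity is what compares shifted weights.

  With poles \<open>t i\<close>, zeros \<open>\<zeta> i\<close> and relative offsets
  \<open>x i / h\<close>, the exact coefficient is the power sum of the poles minus that of the
  zeros, that is \<open>t 0 ^ m\<close> plus the sum of
  \<open>t (Suc i) ^ m - \<zeta> i ^ m\<close>. Replacing each difference by
  \<open>1 - x i / h\<close> times the increment of \<open>t ^ m\<close> over the cell gives the
  moments of a probability measure, because these factors decrease. On a grid the measure therefore
  fits only approximately, and the limit argument has to tolerate a defect in the recurrence. For
  \<open>r\<close> tending to infinity no density is followed; only the recurrence passes to the
  limit.\<close>

abbreviation unit_borel :: "real measure" where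
  "unit_borel \<equiv> restrict_space borel {0..1}"

definition unit_prob :: "real measure \<Rightarrow> bool" where
  "unit_prob M \<longleftrightarrow> prob_space M \<and> sets M = sets unit_borel"

lemma unit_prob_space:
  assumes "unit_prob M"
  shows "space M = {0..1}"
  using assms sets_eq_imp_space_eq[of M unit_borel] by (simp add: unit_prob_def space_restrict_space)

lemma unit_prob_measurable:
  assumes "unit_prob M" "f \<in> borel_measurable borel"
  shows "f \<in> borel_measurable M"
proof -
  have "sets M = sets unit_borel"
    using assms(1) by (simp add: unit_prob_def)
  then have "borel_measurable M = borel_measurable unit_borel"
    by (rule measurable_cong_sets) (rule refl)
  with measurable_restrict_space1[OF assms(2)] show ?thesis by blast
qed

lemma unit_prob_integrable:
  fixes f :: "real \<Rightarrow> 'a::{banach, second_countable_topology}"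
  assumes "unit_prob M" "f \<in> borel_measurable M" "\<And>t. t \<in> {0..1} \<Longrightarrow> norm (f t) \<le> B"
  shows "integrable M f"
proof -
  interpret prob_space M using assms(1) by (simp add: unit_prob_def)
  show ?thesis
    by (rule integrable_const_bound[where B=B]) (use assms unit_prob_space[OF assms(1)] in auto)
qed

lemma unit_prob_distr:
  assumes "prob_space M" "f \<in> borel_measurable M" "\<And>x. x \<in> space M \<Longrightarrow> f x \<in> {0..1}"
  shows "unit_prob (distr M unit_borel f)"
    and "\<And>g :: real \<Rightarrow> real. g \<in> borel_measurable borel \<Longrightarrow>
           integral\<^sup>L (distr M unit_borel f) g = (\<integral>x. g (f x) \<partial>M)"
proof -
  have f: "f \<in> measurable M unit_borel"
    using assms by (auto intro!: measurable_restrict_space2)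
  show "unit_prob (distr M unit_borel f)"
    unfolding unit_prob_def using prob_space.prob_space_distr[OF assms(1) f] by simp
  show "integral\<^sup>L (distr M unit_borel f) g = (\<integral>x. g (f x) \<partial>M)"
    if "g \<in> borel_measurable borel" for g :: "real \<Rightarrow> real"
    by (rule integral_distr[OF f measurable_restrict_space1[OF that]])
qed

text \<open>Selection of weakly convergent subsequences works on the whole line, and tightness is
  phrased with half-open intervals; \<open>{-1<..1}\<close> is one that contains both end points of
  \<open>{0..1}\<close>.\<close>

lemma unit_prob_real_distribution:
  assumes "unit_prob M"
  shows "real_distribution (distr M borel id)"
    and "measure (distr M borel id) {-1<..1} = 1"
    and "\<And>f :: real \<Rightarrow> real. f \<in> borel_measurable borel \<Longrightarrow>
      integral\<^sup>L (distr M borel id) f = integral\<^sup>L M f"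
proof -
  interpret prob_space M using assms by (simp add: unit_prob_def)
  have id: "id \<in> borel_measurable M"
    by (rule unit_prob_measurable[OF assms]) simp
  have "prob_space (distr M borel id)"
    by (rule prob_space_distr[OF id])
  then show "real_distribution (distr M borel id)"
    by (simp add: real_distribution_def real_distribution_axioms_def)
  show "measure (distr M borel id) {-1<..1} = 1"
  proof -
    have "id -` {-1<..1::real} \<inter> space M = space M"
      using unit_prob_space[OF assms] by auto
    then show ?thesis
      using prob_space by (simp add: measure_distr[OF id])
  qed
  show "integral\<^sup>L (distr M borel id) f = integral\<^sup>L M f" 
    if "f \<in> borel_measurable borel" for f :: "real \<Rightarrow> real"
    using integral_distr[OF id that] by simp
qed

text \<open>Helly selection: all measures live on one compact interval and are therefore tight. A
  single subsequence serves all moments at once.\<close>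

lemma unit_prob_moments_compact:
  fixes M :: "nat \<Rightarrow> real measure"
  assumes M: "\<And>i. unit_prob (M i)"
  obtains r M' where "strict_mono (r :: nat \<Rightarrow> nat)" "unit_prob M'"
    "\<And>n::nat. (\<lambda>i. \<integral>t. t ^ n \<partial>M (r i)) \<longlonglongrightarrow> (\<integral>t. t ^ n \<partial>M')"
proof -
  define N where "N i = distr (M i) borel id" for i
  \<comment> \<open>\<open>clamp\<close> makes powers bounded on the line without changing their
    integrals over the unit interval, and it pushes the weak limit into the unit interval without a
    study of its support.\<close>
  define clamp where "clamp t = max 0 (min 1 (t::real))" for t
  have [measurable]: "clamp \<in> borel_measurable borel"
    unfolding clamp_def by measurable
  have clamp01: "clamp t \<in> {0..1}" for t
    by (simp add: clamp_def)
  have N: "real_distribution (N i)" "measure (N i) {-1<..1} = 1" for i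
    using unit_prob_real_distribution[OF M] by (simp_all add: N_def)
  have "tight N"
    unfolding tight_def
  proof (intro conjI allI impI)
    show "\<exists>a b. a < b \<and> (\<forall>n. measure (N n) {a<..b} > 1 - \<epsilon>)" if "\<epsilon> > 0" for \<epsilon> :: real
      by (rule exI[of _ "-1"], rule exI[of _ 1]) (use that N(2) in simp)
  qed (rule N(1))
  then obtain r N' where r: "strict_mono r" "real_distribution N'" "weak_conv_m (N \<circ> id \<circ> r) N'"
    using tight_imp_convergent_subsubsequence[of N id] by (metis strict_mono_id)
  interpret N': real_distribution N' by fact
  define M' where "M' = distr N' unit_borel clamp"
  have M': "unit_prob M'" "g \<in> borel_measurable borel \<Longrightarrow>
           integral\<^sup>L M' g = (\<integral>x. g (clamp x) \<partial>N')" for g :: "real \<Rightarrow> real"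
    unfolding M'_def using clamp01 unit_prob_distr[OF N'.prob_space_axioms, of clamp] by auto
  have "(\<lambda>i. \<integral>t. t ^ n \<partial>M (r i)) \<longlonglongrightarrow> (\<integral>t. t ^ n \<partial>M')" for n :: nat
  proof -
    have "(\<lambda>i. integral\<^sup>L ((N \<circ> id \<circ> r) i) (\<lambda>x. clamp x ^ n)) \<longlonglongrightarrow> integral\<^sup>L N' (\<lambda>x. clamp x ^ n)"
    proof (rule weak_conv_imp_integral_bdd_continuous_conv)
      show "isCont (\<lambda>x. clamp x ^ n) x" for x
        unfolding clamp_def by (intro continuous_intros)
      show "norm (clamp x ^ n) \<le> 1" for x
        using clamp01[of x] by (simp add: power_le_one)
    qed (use N r in \<open>auto simp: o_def\<close>)
    moreover have "integral\<^sup>L ((N \<circ> id \<circ> r) i) (\<lambda>x. clamp x ^ n) = (\<integral>t. t ^ n \<partial>M (r i))" for i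
    proof -
      have "integral\<^sup>L ((N \<circ> id \<circ> r) i) (\<lambda>x. clamp x ^ n) = (\<integral>t. clamp t ^ n \<partial>M (r i))"
        using unit_prob_real_distribution(3)[OF M, of "\<lambda>x. clamp x ^ n" "r i"] by (simp add: N_def)
      also have "\<dots> = (\<integral>t. t ^ n \<partial>M (r i))"
        by (rule Bochner_Integration.integral_cong)
          (auto simp: unit_prob_space[OF M] clamp_def)
      finally show ?thesis .
    qed
    ultimately show ?thesis
      using M'(2)[of "\<lambda>t. t ^ n"] by simp
  qed
  with that r(1) M'(1) show ?thesis by blast
qed

text \<open>In terms of generating functions: \<open>z G' = (\<Sum>j\<ge>1. c\<^sub>j z\<^sup>j) G\<close>, where \<open>c\<close> is the moment
  sequence of a probability measure on the unit interval.\<close>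

definition moment_recurrent :: "(nat \<Rightarrow> real) \<Rightarrow> bool" where
  "moment_recurrent b \<longleftrightarrow> (\<exists>M. unit_prob M \<and>
     (\<forall>n. real n * b n = (\<Sum>j=1..n. (\<integral>t. t ^ j \<partial>M) * b (n - j))))"

text \<open>Each equation involves finitely many moments, so it passes to the limit along the
  subsequence. The vanishing defect leaves room for measures whose moments only approximate the
  coefficients of the recurrence.\<close>

lemma moment_recurrent_limit_perturbed:
  assumes M: "\<And>i. unit_prob (M i)"
    and b: "\<And>n. (\<lambda>i. b i n) \<longlonglongrightarrow> b' n"
    and rec: "\<And>n. (\<lambda>i. real n * b i n - (\<Sum>j=1..n. (\<integral>t. t ^ j \<partial>M i) * b i (n - j))) \<longlonglongrightarrow> 0"
  shows "moment_recurrent b'"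
proof -
  obtain r M' where r: "strict_mono (r :: nat \<Rightarrow> nat)" and M': "unit_prob M'"
    and lim: "\<And>n::nat. (\<lambda>i. \<integral>t. t ^ n \<partial>M (r i)) \<longlonglongrightarrow> (\<integral>t. t ^ n \<partial>M')"
    by (rule unit_prob_moments_compact[of M, OF M]) (rule that; assumption)
  have "real n * b' n = (\<Sum>j=1..n. (\<integral>t. t ^ j \<partial>M') * b' (n - j))" for n
  proof -
    have br: "(\<lambda>i. b (r i) n) \<longlonglongrightarrow> b' n" for n
      using LIMSEQ_subseq_LIMSEQ[OF b[of n] r] by (simp add: o_def)
    have "(\<lambda>i. real n * b (r i) n - (\<Sum>j=1..n. (\<integral>t. t ^ j \<partial>M (r i)) * b (r i) (n - j)))
        \<longlonglongrightarrow> real n * b' n - (\<Sum>j=1..n. (\<integral>t. t ^ j \<partial>M') * b' (n - j))"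
      by (intro tendsto_intros br lim)
    moreover have "(\<lambda>i. real n * b (r i) n - (\<Sum>j=1..n. (\<integral>t. t ^ j \<partial>M (r i)) * b (r i) (n - j))) \<longlonglongrightarrow> 0"
      using LIMSEQ_subseq_LIMSEQ[OF rec[of n] r] by (simp add: o_def)
    ultimately have "real n * b' n - (\<Sum>j=1..n. (\<integral>t. t ^ j \<partial>M') * b' (n - j)) = 0"
      by (rule LIMSEQ_unique)
    then show ?thesis by simp
  qed
  with M' show ?thesis unfolding moment_recurrent_def by blast
qed

lemma moment_recurrent_limit:
  assumes "\<And>i. moment_recurrent (b i)" and "\<And>n. (\<lambda>i. b i n) \<longlonglongrightarrow> b' n"
  shows "moment_recurrent b'"
proof -
  have "\<forall>i. \<exists>M. unit_prob M \<and> (\<forall>n. real n * b i n = (\<Sum>j=1..n. (\<integral>t. t ^ j \<partial>M) * b i (n - j)))"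
    using assms(1) by (simp only: moment_recurrent_def) blast
  from choice[OF this] obtain M where M': "\<forall>i. unit_prob (M i) \<and>
      (\<forall>n. real n * b i n = (\<Sum>j=1..n. (\<integral>t. t ^ j \<partial>M i) * b i (n - j)))" ..
  have M: "unit_prob (M i)"
    "real n * b i n = (\<Sum>j=1..n. (\<integral>t. t ^ j \<partial>M i) * b i (n - j))" for i n
    using M' by blast+
  show ?thesis
    by (rule moment_recurrent_limit_perturbed[of M b, OF M(1) assms(2)])
      (simp only: M(2)[symmetric] diff_self tendsto_const)
qed

section \<open>Zeros of partial fractions\<close>

lemma partial_fraction_root:
  fixes t w :: "nat \<Rightarrow> real"
  assumes t: "strict_mono t" and w: "\<And>i. w i > 0" and i: "i < N"
  shows "\<exists>z. t i < z \<and> z < t (Suc i) \<and> (\<Sum>j\<le>N. w j / (z - t j)) = 0"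
proof -
  define S where "S = {..N} - {i, Suc i}"
  \<comment> \<open>Clearing the two adjacent poles leaves a function continuous on the closed
    interval. At either end point only one of the first two summands survives, with opposite
    signs.\<close>
  define f where "f z = w i * (z - t (Suc i)) + w (Suc i) * (z - t i)
      + (z - t i) * (z - t (Suc i)) * (\<Sum>j\<in>S. w j / (z - t j))" for z
  have less: "t i < t (Suc i)"
    using t by (simp add: strict_mono_def)
  have ne: "z \<noteq> t j" if "z \<in> {t i..t (Suc i)}" "j \<in> S" for z j
  proof -
    have "j < i \<or> Suc i < j" using that(2) by (auto simp: S_def)
    then have "t j < t i \<or> t (Suc i) < t j" using t by (auto simp: strict_mono_def)
    with that(1) show ?thesis by auto
  qed
  have "continuous_on {t i..t (Suc i)} f"
    unfolding f_def by (intro continuous_intros) (use ne in auto)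
  moreover have neg: "f (t i) < 0" and pos: "f (t (Suc i)) > 0"
    using less w[of i] w[of "Suc i"] by (auto simp: f_def intro: mult_pos_neg)
  ultimately obtain z where z: "t i \<le> z" "z \<le> t (Suc i)" "f z = 0"
    using IVT'[of f "t i" 0 "t (Suc i)"] less by auto
  with neg pos have z': "t i < z" "z < t (Suc i)"
    by (auto simp: less_le)
  have "{..N} = insert i (insert (Suc i) S)" "finite S" "i \<notin> S" "Suc i \<notin> S"
    using i by (auto simp: S_def)
  then have "(\<Sum>j\<le>N. w j / (z - t j)) = w i / (z - t i) + (w (Suc i) / (z - t (Suc i)) + (\<Sum>j\<in>S. w j / (z - t j)))"
    by simp
  also have "\<dots> = f z / ((z - t i) * (z - t (Suc i)))"
    using z' by (simp add: f_def field_simps)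
  finally show ?thesis using z z' by auto
qed

section \<open>Coefficient recurrences from poles and zeros\<close>

context
begin

private definition lin :: "real \<Rightarrow> real fps" where
  "lin c = 1 - fps_const c * fps_X"

private definition geo :: "real \<Rightarrow> real fps" where
  "geo c = Abs_fps (\<lambda>n. c ^ n)"

text \<open>The series of \<open>c X / (1 - c X)\<close>: minus \<open>X\<close> times the
  logarithmic derivative of \<open>lin c\<close>, with the powers of \<open>c\<close> as
  coefficients.\<close>

private definition geo' :: "real \<Rightarrow> real fps" where
  "geo' c = Abs_fps (\<lambda>n. if n = 0 then 0 else c ^ n)"

private lemma geo_lin: "geo c * lin c = 1"
proof (rule fps_ext)
  fix n show "(geo c * lin c) $ n = 1 $ n"
    by (cases n) (simp_all add: lin_def geo_def algebra_simps)
qed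

private lemma geo'_lin: "geo' c * lin c = fps_const c * fps_X"
proof (rule fps_ext)
  fix n show "(geo' c * lin c) $ n = (fps_const c * fps_X) $ n"
    by (cases n) (auto simp add: lin_def geo'_def algebra_simps)
qed

private lemma deriv_prod_lin:
  assumes "finite I"
  shows "fps_X * fps_deriv (\<Prod>i\<in>I. lin (c i)) = - (\<Sum>i\<in>I. geo' (c i)) * (\<Prod>i\<in>I. lin (c i))"
  using assms
proof (induction I)
  case (insert x I)
  have *: "fps_X * fps_deriv (lin (c x)) = - (geo' (c x) * lin (c x))"
    unfolding geo'_lin by (simp add: lin_def)
  have "fps_X * fps_deriv (\<Prod>i\<in>insert x I. lin (c i)) =
      (fps_X * fps_deriv (lin (c x))) * (\<Prod>i\<in>I. lin (c i)) + lin (c x) * (fps_X * fps_deriv (\<Prod>i\<in>I. lin (c i)))"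
    using insert.hyps by (simp add: algebra_simps)
  then show ?case
    using insert.hyps unfolding * insert.IH by (simp add: algebra_simps)
qed simp

private lemma lin_poly: "lin c = fps_of_poly [:1, - c:]"
  by (simp add: lin_def fps_of_poly_pCons mult.commute)

private lemma degree_prod_linear:
  fixes c :: "'a \<Rightarrow> real"
  assumes "finite A"
  shows "degree (\<Prod>l\<in>A. [:1, - c l:]) \<le> card A"
proof -
  have "degree (\<Prod>l\<in>A. [:1, - c l:]) \<le> (\<Sum>l\<in>A. degree [:1, - c l:])"
    using degree_prod_sum_le[OF assms, of "\<lambda>l. [:1, - c l:]"] by (simp add: o_def)
  also have "\<dots> \<le> (\<Sum>l\<in>A. 1)" by (intro sum_mono) simp
  finally show ?thesis by simp
qed

text \<open>The sum of \<open>w i / (1 - t i X)\<close> is a constant times the product of the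
  \<open>1 - \<zeta> j X\<close> divided by that of the \<open>1 - t i X\<close>. Its logarithmic
  derivative is a difference of power sums, and comparing coefficients gives the recurrence.\<close>

lemma partial_fraction_recurrence:
  fixes t w :: "'i \<Rightarrow> real" and \<zeta> :: "'j \<Rightarrow> real"
  assumes fin: "finite I" "finite J" and card: "card I = Suc (card J)"
    and inj: "inj_on \<zeta> J" and nz: "\<And>j. j \<in> J \<Longrightarrow> \<zeta> j \<noteq> 0"
    and ne: "\<And>i j. i \<in> I \<Longrightarrow> j \<in> J \<Longrightarrow> \<zeta> j \<noteq> t i"
    and root: "\<And>j. j \<in> J \<Longrightarrow> (\<Sum>i\<in>I. w i / (\<zeta> j - t i)) = 0"
  shows "real n * (\<Sum>i\<in>I. w i * t i ^ n) =
    (\<Sum>l=1..n. ((\<Sum>i\<in>I. t i ^ l) - (\<Sum>j\<in>J. \<zeta> j ^ l)) * (\<Sum>i\<in>I. w i * t i ^ (n - l)))"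
proof -
  define P where "P = (\<Sum>i\<in>I. smult (w i) (\<Prod>l\<in>I-{i}. [:1, - t l:]))"
  define R where "R = smult (\<Sum>i\<in>I. w i) (\<Prod>j\<in>J. [:1, - \<zeta> j:])"
  have "P = R"
  \<comment> \<open>Both degrees are at most \<open>card J\<close>. The polynomials agree at 0,
    where each has the value \<open>\<Sum>i\<in>I. w i\<close>, and at the reciprocals of the zeros,
    where both vanish: \<open>card J + 1\<close> points.\<close>
  proof (rule poly_eqI_degree[of "insert 0 ((\<lambda>j. 1 / \<zeta> j) ` J)"])
    have "inj_on (\<lambda>j. 1 / \<zeta> j) J"
      using inj by (auto simp: inj_on_def)
    then have c: "card (insert 0 ((\<lambda>j. 1 / \<zeta> j) ` J)) = Suc (card J)"
      using fin nz by (subst card_insert_disjoint) (auto simp: card_image)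
    have "degree P \<le> card J"
      unfolding P_def
    proof (rule degree_sum_le[OF fin(1)])
      fix i assume "i \<in> I"
      then have "card (I - {i}) = card J" using card fin by simp
      then show "degree (smult (w i) (\<Prod>l\<in>I - {i}. [:1, - t l:])) \<le> card J"
        using degree_prod_linear[of "I - {i}" t] fin degree_smult_le[of "w i"] by (metis finite_Diff order.trans)
    qed
    then show "degree P < card (insert 0 ((\<lambda>j. 1 / \<zeta> j) ` J))" unfolding c by simp
    have "degree R \<le> card J"
      unfolding R_def using degree_prod_linear[of J \<zeta>] fin degree_smult_le order.trans by blast
    then show "degree R < card (insert 0 ((\<lambda>j. 1 / \<zeta> j) ` J))" unfolding c by simp
  next
    fix x assume "x \<in> insert 0 ((\<lambda>j. 1 / \<zeta> j) ` J)"
    then consider "x = 0" | j where "j \<in> J" "x = 1 / \<zeta> j" by auto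
    then show "poly P x = poly R x"
    proof cases
      case 1
      then show ?thesis by (simp add: P_def R_def poly_sum poly_prod)
    next
      case 2
      have f0: "1 - t i / \<zeta> j \<noteq> 0" if "i \<in> I" for i
        using ne[OF that 2(1)] nz[OF 2(1)] by (simp add: field_simps)
      have "poly P x = (\<Sum>i\<in>I. w i * (\<Prod>l\<in>I-{i}. 1 - t l / \<zeta> j))"
        by (simp add: P_def poly_sum poly_prod 2)
      also have "\<dots> = (\<Sum>i\<in>I. (\<zeta> j * (\<Prod>l\<in>I. 1 - t l / \<zeta> j)) * (w i / (\<zeta> j - t i)))"
      proof (rule sum.cong[OF refl])
        fix i assume i: "i \<in> I"
        define q where "q = (\<Prod>l\<in>I-{i}. 1 - t l / \<zeta> j)"
        have "(\<Prod>l\<in>I. 1 - t l / \<zeta> j) = (1 - t i / \<zeta> j) * q"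
          using prod.remove[OF fin(1) i] by (simp add: q_def)
        then show "w i * (\<Prod>l\<in>I-{i}. 1 - t l / \<zeta> j) = (\<zeta> j * (\<Prod>l\<in>I. 1 - t l / \<zeta> j)) * (w i / (\<zeta> j - t i))"
          unfolding q_def[symmetric] using ne[OF i 2(1)] nz[OF 2(1)]
          by (simp only:) (simp add: field_simps)
      qed
      also have "\<dots> = 0"
        unfolding sum_distrib_left[symmetric] root[OF 2(1)] by simp
      also have "poly R x = 0"
        using 2 fin nz by (auto simp: R_def poly_prod)
      finally show ?thesis by simp
    qed
  qed
  define B where "B = (\<Sum>i\<in>I. fps_const (w i) * geo (t i))"
  define T where "T = (\<Prod>i\<in>I. lin (t i))"
  define Z where "Z = (\<Prod>j\<in>J. lin (\<zeta> j))"
  define W where "W = fps_const (\<Sum>i\<in>I. w i)"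
  have "B * T = (\<Sum>i\<in>I. fps_const (w i) * (\<Prod>l\<in>I-{i}. lin (t l)))"
    unfolding B_def sum_distrib_right
  proof (rule sum.cong[OF refl])
    fix i assume i: "i \<in> I"
    have "T = lin (t i) * (\<Prod>l\<in>I-{i}. lin (t l))"
      unfolding T_def using prod.remove[OF fin(1) i] .
    then have "fps_const (w i) * geo (t i) * T = fps_const (w i) * (geo (t i) * lin (t i)) * (\<Prod>l\<in>I-{i}. lin (t l))"
      by (simp add: mult_ac)
    then show "fps_const (w i) * geo (t i) * T = fps_const (w i) * (\<Prod>l\<in>I-{i}. lin (t l))"
      by (simp add: geo_lin)
  qed
  also have "\<dots> = fps_of_poly P"
    by (simp add: P_def lin_poly fps_of_poly_sum fps_of_poly_smult fps_of_poly_prod)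
  also have "\<dots> = W * Z"
    unfolding \<open>P = R\<close> by (simp add: R_def W_def Z_def lin_poly fps_of_poly_smult fps_of_poly_prod)
  finally have BT: "B * T = W * Z" .
  have dT: "fps_X * fps_deriv T = - (\<Sum>i\<in>I. geo' (t i)) * T"
    unfolding T_def by (rule deriv_prod_lin[OF fin(1)])
  have dZ: "fps_X * fps_deriv Z = - (\<Sum>j\<in>J. geo' (\<zeta> j)) * Z"
    unfolding Z_def by (rule deriv_prod_lin[OF fin(2)])
  have "fps_X * fps_deriv (B * T) = fps_X * fps_deriv (W * Z)"
    by (simp only: BT)
  then have "fps_X * fps_deriv B * T + B * (fps_X * fps_deriv T) = W * (fps_X * fps_deriv Z)"
    by (simp add: W_def algebra_simps)
  also have "\<dots> = - (\<Sum>j\<in>J. geo' (\<zeta> j)) * (B * T)"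
    unfolding dZ BT by (simp add: algebra_simps)
  finally have "(fps_X * fps_deriv B) * T =
      (((\<Sum>i\<in>I. geo' (t i)) - (\<Sum>j\<in>J. geo' (\<zeta> j))) * B) * T"
    unfolding dT by (simp add: algebra_simps)
  moreover have "T \<noteq> 0"
  proof -
    have "lin c \<noteq> 0" for c
      using geo_lin[of c] by auto
    then show ?thesis unfolding T_def using fin by simp
  qed
  ultimately have "fps_X * fps_deriv B = ((\<Sum>i\<in>I. geo' (t i)) - (\<Sum>j\<in>J. geo' (\<zeta> j))) * B"
    by simp
  then have "(fps_X * fps_deriv B) $ n = (((\<Sum>i\<in>I. geo' (t i)) - (\<Sum>j\<in>J. geo' (\<zeta> j))) * B) $ n"
    by simp
  also have "(fps_X * fps_deriv B) $ n = real n * B $ n"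
    by (cases n) (simp_all)
  also have "(((\<Sum>i\<in>I. geo' (t i)) - (\<Sum>j\<in>J. geo' (\<zeta> j))) * B) $ n =
     (\<Sum>l=0..n. ((\<Sum>i\<in>I. geo' (t i) $ l) - (\<Sum>j\<in>J. geo' (\<zeta> j) $ l)) * B $ (n - l))"
    by (simp add: fps_mult_nth fps_sum_nth)
  also have "\<dots> = (\<Sum>l=1..n. ((\<Sum>i\<in>I. t i ^ l) - (\<Sum>j\<in>J. \<zeta> j ^ l)) * B $ (n - l))"
    by (rule sum.mono_neutral_cong_right) (auto simp: geo'_def)
  finally show ?thesis
    by (simp add: B_def fps_sum_nth geo_def)
qed

end

text \<open>With indices relative to the cell, both equations have the kernel
  \<open>1 / (exp x - exp (m h))\<close>, which decreases in \<open>x\<close> on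
  \<open>(0, h)\<close>. If \<open>x' < x\<close>, the first sum becomes positive at
  \<open>x'\<close>; log-concavity bounds \<open>P (i + 1)\<close> times it by \<open>P i\<close>
  times the second sum, which is 0.\<close>

lemma partial_fraction_roots_mono:
  fixes P :: "int \<Rightarrow> real" and h x x' :: real
  assumes nonneg: "\<And>i. P i \<ge> 0"
    and lc: "\<And>i j. i \<le> j \<Longrightarrow> P i * P (j + 1) \<le> P (i + 1) * P j"
    and pos: "P i > 0" "P (i + 1) > 0" and x: "0 < x" "x < h" and x': "0 < x'" "x' < h"
    and N: "N \<ge> 0"
    and zero: "(\<Sum>m=-N..N. P (i + m) / (exp x - exp (of_int m * h))) = 0"
    and zero': "(\<Sum>m=-N..N. P (i + 1 + m) / (exp x' - exp (of_int m * h))) = 0"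
  shows "x \<le> x'"
proof (rule ccontr)
  assume "\<not> x \<le> x'"
  then have less: "x' < x" by simp
  have h: "h > 0" using x by simp
  have below: "exp (of_int m * h) < exp y" if "m \<le> 0" "0 < y" for m y
  proof -
    have "of_int m * h \<le> 0" using that h by (simp add: mult_nonpos_nonneg)
    with that show ?thesis by simp
  qed
  have above: "exp y < exp (of_int m * h)" if "m > 0" "y < h" for m y
  proof -
    have "1 * h \<le> of_int m * h" using that h by (intro mult_right_mono) auto
    with that show ?thesis by simp
  qed
  have dec: "1 / (exp x - exp (of_int m * h)) < 1 / (exp x' - exp (of_int m * h))" for m
  proof (cases "m \<le> 0")
    case True
    then show ?thesis using below[OF True x(1)] below[OF True x'(1)] less
      by (intro divide_strict_left_mono) auto
  next
    case False
    then show ?thesis using above[of m x] above[of m x'] less x x'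
      by (intro divide_strict_left_mono) (auto intro: mult_neg_neg)
  qed
  have "0 < (\<Sum>m=-N..N. P (i + m) / (exp x' - exp (of_int m * h)))"
  proof -
    have "(\<Sum>m=-N..N. P (i + m) / (exp x - exp (of_int m * h)))
        < (\<Sum>m=-N..N. P (i + m) / (exp x' - exp (of_int m * h)))"
    proof (rule sum_strict_mono_ex1)
      show "\<forall>m\<in>{-N..N}. P (i + m) / (exp x - exp (of_int m * h)) \<le> P (i + m) / (exp x' - exp (of_int m * h))"
        using mult_left_mono[OF less_imp_le[OF dec] nonneg] by auto
      show "\<exists>m\<in>{-N..N}. P (i + m) / (exp x - exp (of_int m * h)) < P (i + m) / (exp x' - exp (of_int m * h))"
        using mult_strict_left_mono[OF dec[of 0] pos(1)] N by (intro bexI[of _ 0]) auto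
    qed simp
    with zero show ?thesis by simp
  qed
  then have "0 < P (i + 1) * (\<Sum>m=-N..N. P (i + m) / (exp x' - exp (of_int m * h)))"
    using pos by simp
  \<comment> \<open>At \<open>m = 0\<close> the log-concavity inequality changes direction and the
    kernel changes sign, so every term moves the same way.\<close>
  also have "\<dots> \<le> P i * (\<Sum>m=-N..N. P (i + 1 + m) / (exp x' - exp (of_int m * h)))"
    unfolding sum_distrib_left
  proof (rule sum_mono)
    fix m
    show "P (i + 1) * (P (i + m) / (exp x' - exp (of_int m * h)))
        \<le> P i * (P (i + 1 + m) / (exp x' - exp (of_int m * h)))"
    proof (cases "m \<le> 0")
      case True
      have "P (i + 1) * P (i + m) \<le> P i * P (i + 1 + m)"
        using lc[of "i + m" i] True by (simp add: algebra_simps)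
      with below[OF True x'(1)] show ?thesis
        by (simp add: divide_right_mono)
    next
      case False
      have "P i * P (i + 1 + m) \<le> P (i + 1) * P (i + m)"
        using lc[of i "i + m"] False by (simp add: algebra_simps)
      with above[of m x'] False x' show ?thesis
        by (simp add: divide_right_mono_neg)
    qed
  qed
  also have "\<dots> = 0" using zero' by simp
  finally show False by simp
qed

section \<open>The logistic grid\<close>

definition logistic :: "real \<Rightarrow> real" where
  "logistic y = 1 / (1 + exp (- y))"

lemma exp_add_one_pos: "1 + exp y > (0::real)"
  by (simp add: add_pos_pos)

lemma logistic_pos: "0 < logistic y" and logistic_less_1: "logistic y < 1"
  using exp_add_one_pos[of "- y"] by (simp_all add: logistic_def field_simps)

lemma one_minus_logistic: "1 - logistic y = logistic (- y)"
  using exp_add_one_pos[of "- y"] exp_add_one_pos[of "y"]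
  by (simp add: logistic_def field_simps exp_minus)

lemma exp_eq_logistic: "exp y = logistic y / (1 - logistic y)"
  using exp_add_one_pos[of "- y"] by (simp add: logistic_def field_simps exp_minus)

lemma DERIV_logistic:
  "(logistic has_real_derivative logistic y * (1 - logistic y)) (at y within A)"
  unfolding logistic_def
  by (rule derivative_eq_intros refl | use exp_add_one_pos[of "- y"] in \<open>simp add: field_simps power2_eq_square\<close>)+

lemma logistic_strict_mono: "strict_mono logistic"
proof (rule strict_monoI)
  show "logistic x < logistic y" if "x < y" for x y
    using that exp_add_one_pos[of "- y"] exp_add_one_pos[of "- x"]
    by (simp add: logistic_def field_simps)
qed

lemma logistic_less_iff [simp]: "logistic x < logistic y \<longleftrightarrow> x < y"
  by (rule strict_mono_less[OF logistic_strict_mono])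

lemma logistic_surj: "0 < t \<Longrightarrow> t < 1 \<Longrightarrow> logistic (ln (t / (1 - t))) = t"
  by (simp add: logistic_def exp_minus field_simps)

lemma continuous_logistic [continuous_intros]: "continuous_on A f \<Longrightarrow> continuous_on A (\<lambda>x. logistic (f x))"
  unfolding logistic_def by (intro continuous_intros ballI exp_add_one_pos[THEN less_imp_neq, symmetric])

lemma logistic_measurable [measurable]: "logistic \<in> borel_measurable borel"
  unfolding logistic_def by measurable

text \<open>The second derivative of the power is bounded by \<open>m * (m + 1)\<close>, so the two
  mean values of the first derivative differ by at most that times \<open>h\<close>. The second
  order matters: \<open>N\<close> cells of width \<open>h = (b - a) / N\<close> still add up to
  something of order \<open>h\<close>.\<close>

lemma logistic_power_interpolation:
  assumes "0 \<le> x" "x \<le> h" "0 < h"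
  shows "\<bar>logistic (y + x) ^ m - logistic y ^ m - x / h * (logistic (y + h) ^ m - logistic y ^ m)\<bar>
      \<le> real m * (real m + 1) * h\<^sup>2"
proof (cases "x = 0")
  case False
  with assms have x: "0 < x" by simp
  define d where "d z = real m * (logistic z ^ m * (1 - logistic z))" for z
  have e: "((\<lambda>z. logistic z ^ m) has_real_derivative d z) (at z within A)" for z A
  proof -
    have "((\<lambda>z. logistic z ^ m) has_real_derivative
        real m * (logistic z * (1 - logistic z)) * logistic z ^ (m - Suc 0)) (at z within A)"
      by (rule derivative_eq_intros DERIV_logistic refl | simp)+
    also have "real m * (logistic z * (1 - logistic z)) * logistic z ^ (m - Suc 0) = d z"
      by (cases m) (simp_all add: d_def)
    finally show ?thesis .
  qed
  define d' where "d' z = real m * (d z * (1 - logistic z) - logistic z ^ m * (logistic z * (1 - logistic z)))" for z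
  have d: "(d has_real_derivative d' z) (at z within A)" for z A
    unfolding d_def
    by (rule derivative_eq_intros DERIV_logistic e refl | simp add: d'_def algebra_simps)+
  have d'_le: "\<bar>d' z\<bar> \<le> real m * (real m + 1)" for z
  proof -
    have "0 \<le> logistic z" "logistic z \<le> 1" "0 \<le> logistic z ^ m" "logistic z ^ m \<le> 1"
      using logistic_pos[of z] logistic_less_1[of z] by (auto intro: power_le_one simp: less_imp_le)
    then have "\<bar>logistic z ^ m * (1 - logistic z)\<bar> \<le> 1 * 1" "\<bar>logistic z ^ m * (logistic z * (1 - logistic z))\<bar> \<le> 1 * (1 * 1)"
      "\<bar>1 - logistic z\<bar> \<le> 1"
      unfolding abs_mult by ((intro mult_mono; simp), (intro mult_mono; simp), simp)
    moreover from this have "\<bar>d z * (1 - logistic z)\<bar> \<le> (real m * 1) * 1"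
      unfolding abs_mult d_def by (intro mult_mono) auto
    ultimately have "\<bar>d z * (1 - logistic z) - logistic z ^ m * (logistic z * (1 - logistic z))\<bar> \<le> real m + 1"
      by linarith
    then show ?thesis
      unfolding d'_def abs_mult by (simp add: mult_left_mono)
  qed
  obtain u where u: "y < u" "u < y + x" "logistic (y + x) ^ m - logistic y ^ m = x * d u"
    using MVT2[of y "y + x" "\<lambda>z. logistic z ^ m" d] x e by auto
  obtain v where v: "y < v" "v < y + h" "logistic (y + h) ^ m - logistic y ^ m = h * d v"
    using MVT2[of y "y + h" "\<lambda>z. logistic z ^ m" d] assms e by auto
  have "\<bar>d u - d v\<bar> \<le> real m * (real m + 1) * \<bar>u - v\<bar>"
    using field_differentiable_bound[of UNIV d d' "real m * (real m + 1)" u v] d d'_le by simp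
  also have "\<dots> \<le> real m * (real m + 1) * h"
    using u v assms by (intro mult_left_mono) auto
  finally have "x * \<bar>d u - d v\<bar> \<le> h * (real m * (real m + 1) * h)"
    using assms by (intro mult_mono) auto
  moreover have "logistic (y + x) ^ m - logistic y ^ m - x / h * (logistic (y + h) ^ m - logistic y ^ m) = x * (d u - d v)"
    using u v assms by (simp add: algebra_simps)
  ultimately show ?thesis
    using x by (simp only: abs_mult) (simp add: power2_eq_square mult_ac)
qed simp

text \<open>With \<open>U\<close> uniform on \<open>[0,1]\<close>, the measure is the law of \<open>t\<^sub>k\<close> for the random index
  \<open>k = |{i. U < \<alpha>\<^sub>i}|\<close>.\<close>

lemma ex_unit_prob_steps:
  fixes t \<alpha> :: "nat \<Rightarrow> real"
  assumes t: "\<And>i. i \<le> N \<Longrightarrow> t i \<in> {0..1}"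
    and \<alpha>: "\<And>i. i < N \<Longrightarrow> \<alpha> i \<in> {0..1}"
    and dec: "\<And>i. Suc i < N \<Longrightarrow> \<alpha> (Suc i) \<le> \<alpha> i"
  shows "\<exists>M. unit_prob M \<and>
    (\<forall>m::nat. (\<integral>t. t ^ m \<partial>M) = t 0 ^ m + (\<Sum>i<N. \<alpha> i * (t (Suc i) ^ m - t i ^ m)))"
proof -
  define U where "U = uniform_measure lborel {0..1::real}"
  have U: "prob_space U" "space U = UNIV" "sets U = sets borel"
    unfolding U_def by (auto intro!: prob_space_uniform_measure)
  interpret U: prob_space U by (rule U)
  have mU: "measure U {..<a} = a" if "a \<in> {0..1}" for a
  proof -
    have "{0..1} \<inter> {..<a} = {0..<a}" using that by auto
    then show ?thesis using that by (simp add: U_def measure_uniform_measure)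
  qed
  define X where "X u = t 0 + (\<Sum>i<N. indicator {..<\<alpha> i} u * (t (Suc i) - t i))" for u :: real
  have [measurable]: "X \<in> borel_measurable U"
    unfolding X_def measurable_cong_sets[OF U(3) refl] by measurable
  have anti: "\<alpha> j \<le> \<alpha> i" if "i \<le> j" "j < N" for i j
    using that by (induction j rule: dec_induct) (auto intro: order.trans dec)
  \<comment> \<open>As \<open>\<alpha>\<close> decreases, the indices with
    \<open>u < \<alpha> i\<close> form an initial segment and the sum telescopes. One
    \<open>k\<close> has to serve every \<open>g\<close>, since it is used for \<open>t\<close> and
    for its powers.\<close>
  have step: "\<exists>k\<le>N. \<forall>g :: nat \<Rightarrow> real. (\<Sum>i<N. indicator {..<\<alpha> i} u * (g (Suc i) - g i)) = g k - g 0" for u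
  proof -
    define k where "k = (LEAST k. k = N \<or> \<alpha> k \<le> u)"
    have k: "k = N \<or> \<alpha> k \<le> u" "k \<le> N" and below: "i < k \<Longrightarrow> u < \<alpha> i" for i
      unfolding k_def by (rule LeastI[of _ N], simp, rule Least_le, simp) (metis not_less_Least not_le)
    have iff: "u < \<alpha> i \<longleftrightarrow> i < k" if "i < N" for i
    proof
      show "i < k" if "u < \<alpha> i"
      proof (rule ccontr)
        assume "\<not> i < k"
        then show False using k anti[of k i] \<open>i < N\<close> that by auto
      qed
    qed (rule below)
    have "(\<Sum>i<N. indicator {..<\<alpha> i} u * (g (Suc i) - g i)) = g k - g 0" for g :: "nat \<Rightarrow> real"
    proof -
      have "(\<Sum>i<N. indicator {..<\<alpha> i} u * (g (Suc i) - g i)) = (\<Sum>i<k. g (Suc i) - g i)"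
        using k(2) iff by (intro sum.mono_neutral_cong_right) (auto simp: indicator_def)
      then show ?thesis by (simp add: sum_lessThan_telescope)
    qed
    with k(2) show ?thesis by blast
  qed
  have X01: "X u \<in> {0..1}" for u
    using step[of u] t unfolding X_def by (auto simp del: atLeastAtMost_iff)
  have Xm: "X u ^ m = t 0 ^ m + (\<Sum>i<N. indicator {..<\<alpha> i} u * (t (Suc i) ^ m - t i ^ m))" for u m
  proof -
    obtain k where k: "\<And>g :: nat \<Rightarrow> real. (\<Sum>i<N. indicator {..<\<alpha> i} u * (g (Suc i) - g i)) = g k - g 0"
      using step[of u] by blast
    show ?thesis using k[of t] k[of "\<lambda>i. t i ^ m"] by (simp add: X_def)
  qed
  have "(\<integral>t. t ^ m \<partial>(distr U unit_borel X)) = t 0 ^ m + (\<Sum>i<N. \<alpha> i * (t (Suc i) ^ m - t i ^ m))" for m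
  proof -
    have "(\<integral>t. t ^ m \<partial>(distr U unit_borel X)) = (\<integral>u. X u ^ m \<partial>U)"
      by (rule unit_prob_distr(2)) (use U X01 in auto)
    also have "\<dots> = t 0 ^ m + (\<Sum>i<N. (\<integral>u. indicator {..<\<alpha> i} u * (t (Suc i) ^ m - t i ^ m) \<partial>U))"
    proof -
      have i: "integrable U (\<lambda>u. indicator {..<a} u * c)" for a c :: real
        using U by (intro integrable_mult_left) (simp add: U.emeasure_eq_measure)
      have "(\<integral>u. X u ^ m \<partial>U) = (\<integral>u. t 0 ^ m \<partial>U) + (\<integral>u. (\<Sum>i<N. indicator {..<\<alpha> i} u * (t (Suc i) ^ m - t i ^ m)) \<partial>U)"
        unfolding Xm by (intro Bochner_Integration.integral_add Bochner_Integration.integrable_sum i) simp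
      then show ?thesis
        by (simp only: Bochner_Integration.integral_sum[OF i]) (simp add: U.prob_space)
    qed
    also have "\<dots> = t 0 ^ m + (\<Sum>i<N. \<alpha> i * (t (Suc i) ^ m - t i ^ m))"
      using mU \<alpha> U by (intro arg_cong2[where f = "(+)"] sum.cong) auto
    finally show ?thesis .
  qed
  moreover have "unit_prob (distr U unit_borel X)"
    by (rule unit_prob_distr(1)) (use U X01 in auto)
  ultimately show ?thesis by blast
qed

text \<open>For positive \<open>f\<close> this says that \<open>f (s + d) / f s\<close> decreases in
  \<open>s\<close>. The quotient-free form can be multiplied and discretised directly, without a
  logarithm.\<close>

definition log_concave :: "(real \<Rightarrow> real) \<Rightarrow> bool" where
  "log_concave f \<longleftrightarrow> (\<forall>x. 0 \<le> f x) \<and>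
     (\<forall>x y d. x \<le> y \<longrightarrow> 0 \<le> d \<longrightarrow> f x * f (y + d) \<le> f (x + d) * f y)"

lemma log_concaveD: "log_concave f \<Longrightarrow> x \<le> y \<Longrightarrow> 0 \<le> d \<Longrightarrow> f x * f (y + d) \<le> f (x + d) * f y"
  by (simp add: log_concave_def)

text \<open>\<open>c\<close> is exact, the power sums of the poles minus those of the zeros.
  \<open>M\<close> arises by interpolating the powers of each zero linearly within its cell, and the
  bound adds up \<open>N\<close> interpolation errors.\<close>

lemma discrete_moment_recurrent:
  fixes a h :: real and N :: nat
  assumes p: "log_concave p" "\<And>y. p y > 0" and h: "h > 0"
  defines "t \<equiv> (\<lambda>i. logistic (a + real i * h))"
  defines "b \<equiv> (\<lambda>n. \<Sum>i\<le>N. (1 - t i) * p (a + real i * h) * t i ^ n)"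
  obtains M c where "unit_prob M"
    "\<And>n. real n * b n = (\<Sum>l=1..n. c l * b (n - l))"
    "\<And>m. \<bar>c m - (\<integral>t. t ^ m \<partial>M)\<bar> \<le> real m * (real m + 1) * (real N * h\<^sup>2)"
proof -
  define y where "y i = a + real i * h" for i
  define w where "w i = (1 - t i) * p (y i)" for i
  have w: "w i > 0" for i
    using p(2) logistic_less_1 by (simp add: w_def t_def)
  have t: "0 < t i" "t i < 1" "t i = logistic (y i)" for i
    using logistic_pos logistic_less_1 by (simp_all add: t_def y_def)
  have smt: "strict_mono t"
    using h by (auto simp: strict_mono_def t_def)
  have "\<forall>i. \<exists>x. i < N \<longrightarrow> 0 < x \<and> x < h \<and> (\<Sum>j\<le>N. w j / (logistic (y i + x) - t j)) = 0"
  proof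
    fix i
    show "\<exists>x. i < N \<longrightarrow> 0 < x \<and> x < h \<and> (\<Sum>j\<le>N. w j / (logistic (y i + x) - t j)) = 0"
    proof (cases "i < N")
      case True
      obtain z where z: "t i < z" "z < t (Suc i)" "(\<Sum>j\<le>N. w j / (z - t j)) = 0"
        using partial_fraction_root[of t w, OF smt w True] by blast
      \<comment> \<open>The offset of the zero from the pole on its left, measured in the coordinate
        in which all cells have width \<open>h\<close>.\<close>
      define x where "x = ln (z / (1 - z)) - y i"
      have "0 < z" "z < 1" using z t[of i] t[of "Suc i"] by auto
      then have zx: "z = logistic (y i + x)"
        using logistic_surj[of z] by (simp add: x_def)
      have "y (Suc i) = y i + h" by (simp add: y_def algebra_simps)
      then have "0 < x" "x < h"
        using z(1,2) unfolding zx t(3) by simp_all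
      then show ?thesis using z(3) zx by auto
    qed auto
  qed
  then obtain x where x: "\<And>i. i < N \<Longrightarrow> 0 < x i \<and> x i < h"
    and root: "\<And>i. i < N \<Longrightarrow> (\<Sum>j\<le>N. w j / (logistic (y i + x i) - t j)) = 0"
    by metis
  define \<zeta> where "\<zeta> i = logistic (y i + x i)" for i
  have y_Suc: "y (Suc i) = y i + h" for i
    by (simp add: y_def algebra_simps)
  have \<zeta>: "t i < \<zeta> i" "\<zeta> i < t (Suc i)" if "i < N" for i
    using x[OF that] by (simp_all add: \<zeta>_def t(3) y_Suc)
  have \<zeta>_less: "\<zeta> i < \<zeta> j" if "i < j" "j < N" for i j
  proof -
    have "\<zeta> i < t (Suc i)" using that by (intro \<zeta>) simp
    also have "\<dots> \<le> t j" using smt that by (simp add: strict_mono_less_eq)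
    also have "\<dots> < \<zeta> j" using that by (intro \<zeta>)
    finally show ?thesis .
  qed
  have \<zeta>_ne: "\<zeta> j \<noteq> t i" if "j < N" for i j
  proof (cases "i \<le> j")
    case True
    then have "t i \<le> t j" using smt by (simp add: strict_mono_less_eq)
    with \<zeta>[OF that] show ?thesis by simp
  next
    case False
    then have "t (Suc j) \<le> t i" using smt by (simp add: strict_mono_less_eq)
    with \<zeta>[OF that] show ?thesis by simp
  qed
  \<comment> \<open>Extension by 0 lets the equations of all cells run over the same range
    \<open>{-N..N}\<close>. The log-concavity inequality survives, because beyond either end of the
    grid its left side contains a zero factor.\<close>
  define P where "P i = (if 0 \<le> i \<and> i \<le> int N then p (a + of_int i * h) else 0)" for i :: int
  have P_lc: "P i * P (j + 1) \<le> P (i + 1) * P j" if "i \<le> j" for i j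
  proof (cases "0 \<le> i \<and> j + 1 \<le> int N")
    case True
    then show ?thesis
      using that h log_concaveD[OF p(1), of "a + of_int i * h" "a + of_int j * h" h]
      by (simp add: P_def algebra_simps)
  qed (use p that in \<open>auto simp: P_def less_imp_le\<close>)
  have zero: "(\<Sum>m=-int N..int N. P (int i + m) / (exp (x i) - exp (of_int m * h))) = 0" if i: "i < N" for i
  proof -
    have "(\<Sum>m=-int N..int N. P (int i + m) / (exp (x i) - exp (of_int m * h)))
        = (\<Sum>j\<le>N. p (y j) / (exp (x i) - exp ((real j - real i) * h)))"
    proof -
      let ?f = "\<lambda>m. P (int i + m) / (exp (x i) - exp (of_int m * h))"
      have "sum ?f {-int N..int N} = sum ?f ((\<lambda>j. int j - int i) ` {..N})"
      proof (rule sum.mono_neutral_right)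
        have "m \<in> (\<lambda>j. int j - int i) ` {..N}" if "0 \<le> int i + m" "int i + m \<le> int N" for m
          using that by (intro image_eqI[of _ _ "nat (int i + m)"]) auto
        then show "\<forall>m\<in>{-int N..int N} - (\<lambda>j. int j - int i) ` {..N}. ?f m = 0"
          unfolding P_def by auto
      qed (use i in auto)
      also have "\<dots> = (\<Sum>j\<le>N. ?f (int j - int i))"
        by (subst sum.reindex) (auto simp: inj_on_def)
      also have "\<dots> = (\<Sum>j\<le>N. p (y j) / (exp (x i) - exp ((real j - real i) * h)))"
        by (simp add: P_def y_def)
      finally show ?thesis .
    qed
    \<comment> \<open>The return from \<open>y\<close> to \<open>t\<close>: the factor
      \<open>1 - t j\<close> in \<open>w j\<close> cancels the one in the difference of
      exponentials, and what remains in front is common to all terms.\<close>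
    also have "\<dots> = (\<Sum>j\<le>N. (exp (y i) * (1 - \<zeta> i)) * (w j / (\<zeta> i - t j)))"
    proof (rule sum.cong[OF refl])
      fix j
      have "exp (y i) * (exp (x i) - exp ((real j - real i) * h)) = exp (y i + x i) - exp (y j)"
      proof -
        have "y j = y i + (real j - real i) * h" by (simp add: y_def algebra_simps)
        then show ?thesis by (simp only: exp_add) (simp add: algebra_simps)
      qed
      also have "\<dots> = (\<zeta> i - t j) / ((1 - \<zeta> i) * (1 - t j))"
        using logistic_less_1[of "y i + x i"] t(2)[of j]
        unfolding exp_eq_logistic \<zeta>_def[symmetric] t(3)[symmetric] by (simp add: field_simps)
      finally have e: "exp (x i) - exp ((real j - real i) * h) =
          (\<zeta> i - t j) / ((1 - \<zeta> i) * (1 - t j)) / exp (y i)"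
        by (metis exp_not_eq_zero nonzero_mult_div_cancel_left)
      show "p (y j) / (exp (x i) - exp ((real j - real i) * h)) = (exp (y i) * (1 - \<zeta> i)) * (w j / (\<zeta> i - t j))"
        unfolding e w_def by (simp add: field_simps)
    qed
    also have "\<dots> = 0"
      unfolding sum_distrib_left[symmetric] using root[OF i] by (simp add: \<zeta>_def)
    finally show ?thesis .
  qed
  have x_mono: "x i \<le> x (Suc i)" if "Suc i < N" for i
  proof (rule partial_fraction_roots_mono[of P "int i" "x i" h "x (Suc i)" "int N"])
    show "(\<Sum>m=-int N..int N. P (int i + m) / (exp (x i) - exp (of_int m * h))) = 0"
      using that by (intro zero) simp
    show "(\<Sum>m=-int N..int N. P (int i + 1 + m) / (exp (x (Suc i)) - exp (of_int m * h))) = 0"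
      using zero[OF that] by (simp add: add_ac)
  qed (use that p x[of i] x[of "Suc i"] P_lc in \<open>auto simp: P_def less_imp_le\<close>)
  \<comment> \<open>The approximate share of the increment of \<open>t ^ m\<close> over cell
    \<open>i\<close> that lies to the right of the zero.\<close>
  define \<alpha> where "\<alpha> i = 1 - x i / h" for i
  obtain M where M: "unit_prob M"
    "\<And>m. (\<integral>t. t ^ m \<partial>M) = t 0 ^ m + (\<Sum>i<N. \<alpha> i * (t (Suc i) ^ m - t i ^ m))"
  proof -
    have "t i \<in> {0..1}" for i using t[of i] by simp
    moreover have "\<alpha> i \<in> {0..1}" if "i < N" for i
      using x[OF that] h by (simp add: \<alpha>_def field_simps)
    moreover have "\<alpha> (Suc i) \<le> \<alpha> i" if "Suc i < N" for i
      using x_mono[OF that] h by (simp add: \<alpha>_def divide_right_mono)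
    ultimately show ?thesis
      using ex_unit_prob_steps[of N t \<alpha>] that by blast
  qed
  define c where "c m = (\<Sum>i\<le>N. t i ^ m) - (\<Sum>i<N. \<zeta> i ^ m)" for m
  have rec: "real n * b n = (\<Sum>l=1..n. c l * b (n - l))" for n
    unfolding b_def c_def y_def[symmetric] w_def[symmetric]
  proof (rule partial_fraction_recurrence)
    show "inj_on \<zeta> {..<N}"
      by (rule linorder_inj_onI) (use \<zeta>_less in force)+
    show "\<zeta> j \<noteq> 0" for j
      using logistic_pos[of "y j + x j"] by (simp add: \<zeta>_def)
  qed (use \<zeta>_ne root in \<open>auto simp: \<zeta>_def\<close>)
  have "\<bar>c m - (\<integral>t. t ^ m \<partial>M)\<bar> \<le> real m * (real m + 1) * (real N * h\<^sup>2)" for m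
  proof -
    have "c m - (\<integral>t. t ^ m \<partial>M) = - (\<Sum>i<N. \<zeta> i ^ m - t i ^ m - x i / h * (t (Suc i) ^ m - t i ^ m))"
    proof -
      have "(\<Sum>i\<le>N. t i ^ m) = t 0 ^ m + (\<Sum>i<N. t (Suc i) ^ m)"
        using sum.atMost_shift[of "\<lambda>i. t i ^ m" N] by simp
      then show ?thesis
        unfolding c_def M(2) by (simp add: \<alpha>_def sum_subtractf algebra_simps sum.distrib)
    qed
    also have "\<bar>\<dots>\<bar> \<le> (\<Sum>i<N. \<bar>\<zeta> i ^ m - t i ^ m - x i / h * (t (Suc i) ^ m - t i ^ m)\<bar>)"
      unfolding abs_minus by (rule sum_abs)
    also have "\<dots> \<le> (\<Sum>i<N. real m * (real m + 1) * h\<^sup>2)"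
    proof (rule sum_mono)
      fix i assume "i \<in> {..<N}"
      then show "\<bar>\<zeta> i ^ m - t i ^ m - x i / h * (t (Suc i) ^ m - t i ^ m)\<bar> \<le> real m * (real m + 1) * h\<^sup>2"
        using logistic_power_interpolation[of "x i" h "y i" m] x[of i] h
        by (simp add: \<zeta>_def t(3) y_Suc)
    qed
    finally show ?thesis by (simp add: mult_ac)
  qed
  with M(1) rec show ?thesis by (rule that)
qed

section \<open>Refining the grid on a bounded interval\<close>

lemma riemann_sum_error:
  fixes f :: "real \<Rightarrow> real"
  assumes cont: "continuous_on {a..b} f" and h: "0 \<le> h"
    and near: "\<And>x y. x \<in> {a..b} \<Longrightarrow> y \<in> {a..b} \<Longrightarrow> \<bar>x - y\<bar> \<le> h \<Longrightarrow> \<bar>f x - f y\<bar> \<le> e"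
  shows "a + real n * h \<le> b \<Longrightarrow>
    \<bar>h * (\<Sum>i<n. f (a + real i * h)) - integral {a..a + real n * h} f\<bar> \<le> real n * h * e"
proof (induction n)
  case (Suc n)
  let ?x = "a + real n * h"
  have x: "a \<le> ?x" "?x + h \<le> b" and Suc_x: "a + real (Suc n) * h = ?x + h"
    using Suc.prems h by (simp_all add: algebra_simps)
  have int: "f integrable_on {u..v}" if "a \<le> u" "v \<le> b" for u v
    using cont that by (intro integrable_continuous_interval continuous_on_subset[OF cont]) auto
  have "\<bar>f ?x * h - integral {?x..?x + h} f\<bar> \<le> e * h"
  proof -
    have "((\<lambda>y. f ?x - f y) has_integral (f ?x * h - integral {?x..?x + h} f)) {?x..?x + h}"
      using has_integral_const_real[of "f ?x" ?x "?x + h"] h int[of ?x "?x + h"] x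
      by (intro has_integral_diff integrable_integral) (auto simp: mult.commute)
    moreover have "norm (f ?x - f y) \<le> e" if "y \<in> {?x..?x + h}" for y
    proof -
      have "a \<le> y" using x(1) that by (meson atLeastAtMost_iff order.trans)
      with that x h near[of ?x y] show ?thesis by auto
    qed
    moreover have "0 \<le> e"
      using near[of a a] h x by auto
    ultimately show ?thesis
      using has_integral_bound_real[of e "{}" "\<lambda>y. f ?x - f y" "f ?x * h - integral {?x..?x + h} f" ?x "?x + h"] h
      by (simp add: mult.commute)
  qed
  moreover have "integral {a..?x + h} f = integral {a..?x} f + integral {?x..?x + h} f"
    using Henstock_Kurzweil_Integration.integral_combine[of a ?x "?x + h" f] x h int by simp
  moreover have "\<bar>h * (\<Sum>i<n. f (a + real i * h)) - integral {a..?x} f\<bar> \<le> real n * h * e"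
    using Suc.IH x h by simp
  ultimately show ?case
    unfolding Suc_x by (simp add: algebra_simps)
qed simp

lemma riemann_sum_tendsto:
  fixes f :: "real \<Rightarrow> real"
  assumes cont: "continuous_on {a..b} f" and ab: "a < b"
  shows "(\<lambda>N. (b - a) / real N * (\<Sum>i<N. f (a + real i * ((b - a) / real N)))) \<longlonglongrightarrow> integral {a..b} f"
proof (rule LIMSEQ_I)
  fix r :: real assume r: "r > 0"
  define e where "e = r / (2 * (b - a))"
  have e: "e > 0" using r ab by (simp add: e_def)
  obtain d where d: "d > 0" "\<And>x y. x \<in> {a..b} \<Longrightarrow> y \<in> {a..b} \<Longrightarrow> dist y x < d \<Longrightarrow> dist (f y) (f x) < e"
    using compact_uniformly_continuous[OF cont] e by (force simp: uniformly_continuous_on_def)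
  obtain n0 where n0: "(b - a) / d < real n0"
    using reals_Archimedean2 by blast
  show "\<exists>n0. \<forall>N\<ge>n0. norm ((b - a) / real N * (\<Sum>i<N. f (a + real i * ((b - a) / real N))) - integral {a..b} f) < r"
  proof (intro exI allI impI)
    fix N assume N: "Suc n0 \<le> N"
    define h where "h = (b - a) / real N"
    have h: "0 \<le> h" "h < d" "real N * h = b - a"
    proof -
      have "(b - a) / d < real N" using n0 N by simp
      then show "h < d" using d N by (simp add: h_def field_simps)
    qed (use N ab in \<open>auto simp: h_def\<close>)
    have "\<bar>h * (\<Sum>i<N. f (a + real i * h)) - integral {a..a + real N * h} f\<bar> \<le> real N * h * e"
    proof (rule riemann_sum_error[OF cont h(1)])
      show "\<bar>f x - f y\<bar> \<le> e" if "x \<in> {a..b}" "y \<in> {a..b}" "\<bar>x - y\<bar> \<le> h" for x y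
        using d(2)[OF that(2,1)] that(3) h by (simp add: dist_real_def)
    qed (use h in simp)
    also have "real N * h * e = r / 2"
      unfolding h(3) using ab by (simp add: e_def divide_simps)
    also have "\<dots> < r" using r by simp
    finally show "norm ((b - a) / real N * (\<Sum>i<N. f (a + real i * ((b - a) / real N))) - integral {a..b} f) < r"
      unfolding h_def[symmetric] using h by simp
  qed
qed

text \<open>Multiplication by the mesh turns the grid sums into Riemann sums and respects the
  recurrence, which is homogeneous. Since \<open>N h = b - a\<close>, the defect is of order
  \<open>N h^2 = (b - a) h\<close>.\<close>

lemma moment_recurrent_interval:
  assumes p: "log_concave p" "\<And>y. p y > 0" and cont: "continuous_on {a..b} p" and ab: "a < b"
  shows "moment_recurrent (\<lambda>n. integral {a..b} (\<lambda>y. (1 - logistic y) * p y * logistic y ^ n))"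
proof -
  define N where "N k = Suc k" for k
  define h where "h k = (b - a) / real (N k)" for k
  have h: "h k > 0" "real (N k) * h k = b - a" for k
    using ab by (simp_all add: h_def N_def)
  define f where "f n y = (1 - logistic y) * p y * logistic y ^ n" for n y
  define b' where "b' k n = (\<Sum>i\<le>N k. f n (a + real i * h k))" for k n
  have "\<forall>k. \<exists>M c. unit_prob M \<and> (\<forall>n. real n * b' k n = (\<Sum>l=1..n. c l * b' k (n - l))) \<and>
     (\<forall>m. \<bar>c m - (\<integral>t. t ^ m \<partial>M)\<bar> \<le> real m * (real m + 1) * (real (N k) * (h k)\<^sup>2))"
  proof
    fix k
    show "\<exists>M c. unit_prob M \<and> (\<forall>n. real n * b' k n = (\<Sum>l=1..n. c l * b' k (n - l))) \<and>
     (\<forall>m. \<bar>c m - (\<integral>t. t ^ m \<partial>M)\<bar> \<le> real m * (real m + 1) * (real (N k) * (h k)\<^sup>2))"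
      unfolding b'_def f_def
      by (rule discrete_moment_recurrent[OF p h(1), where a = a and N = "N k"]) blast
  qed
  from choice[OF this] obtain M where "\<forall>k. \<exists>c. unit_prob (M k) \<and> (\<forall>n. real n * b' k n = (\<Sum>l=1..n. c l * b' k (n - l))) \<and>
     (\<forall>m. \<bar>c m - (\<integral>t. t ^ m \<partial>M k)\<bar> \<le> real m * (real m + 1) * (real (N k) * (h k)\<^sup>2))" ..
  from choice[OF this] obtain c where Mc: "\<forall>k. unit_prob (M k) \<and> (\<forall>n. real n * b' k n = (\<Sum>l=1..n. c k l * b' k (n - l))) \<and>
     (\<forall>m. \<bar>c k m - (\<integral>t. t ^ m \<partial>M k)\<bar> \<le> real m * (real m + 1) * (real (N k) * (h k)\<^sup>2))" ..
  have M: "unit_prob (M k)"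
    and rec: "real n * b' k n = (\<Sum>l=1..n. c k l * b' k (n - l))"
    and err: "\<bar>c k m - (\<integral>t. t ^ m \<partial>M k)\<bar> \<le> real m * (real m + 1) * (real (N k) * (h k)\<^sup>2)" for k n m
    using Mc by blast+
  have h0: "h \<longlonglongrightarrow> 0"
    unfolding h_def N_def using LIMSEQ_Suc[OF lim_const_over_n[of "b - a"]] by simp
  have c0: "(\<lambda>k. c k m - (\<integral>t. t ^ m \<partial>M k)) \<longlonglongrightarrow> 0" for m
  proof (rule tendsto_rabs_zero_cancel, rule tendsto_sandwich[OF _ _ tendsto_const])
    have "real (N k) * (h k)\<^sup>2 = (b - a) * h k" for k
      using h(2)[of k] by (simp add: power2_eq_square)
    then show "(\<lambda>k. real m * (real m + 1) * (real (N k) * (h k)\<^sup>2)) \<longlonglongrightarrow> 0"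
      using tendsto_mult_left[OF h0, of "real m * (real m + 1) * (b - a)"] by (simp add: mult.assoc)
  qed (use err in auto)
  have lim: "(\<lambda>k. h k * b' k n) \<longlonglongrightarrow> integral {a..b} (f n)" for n
  proof -
    have cf: "continuous_on {a..b} (f n)"
      unfolding f_def by (intro continuous_intros cont)
    \<comment> \<open>The grid has one point more than the Riemann sum, namely \<open>b\<close>; its
      contribution \<open>h k * f n b\<close> vanishes in the limit.\<close>
    have "(\<lambda>k. h k * (\<Sum>i<N k. f n (a + real i * h k)) + h k * f n b) \<longlonglongrightarrow> integral {a..b} (f n) + 0 * f n b"
      using LIMSEQ_Suc[OF riemann_sum_tendsto[OF cf ab]]
      unfolding h_def N_def by (intro tendsto_intros h0[unfolded h_def N_def]) simp
    moreover have "h k * (\<Sum>i<N k. f n (a + real i * h k)) + h k * f n b = h k * b' k n" for k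
      using h(2)[of k] by (simp add: b'_def lessThan_Suc_atMost[symmetric] algebra_simps del: sum.lessThan_Suc)
        (simp add: algebra_simps)
    ultimately show ?thesis by simp
  qed
  show ?thesis
    unfolding f_def[symmetric]
  proof (rule moment_recurrent_limit_perturbed[of M "\<lambda>k n. h k * b' k n", OF M lim])
    fix n
    have "(\<lambda>k. \<Sum>l=1..n. (c k l - (\<integral>t. t ^ l \<partial>M k)) * (h k * b' k (n - l))) \<longlonglongrightarrow>
        (\<Sum>l=1..n. 0 * integral {a..b} (f (n - l)))"
      by (intro tendsto_intros c0 lim)
    moreover have "(\<Sum>l=1..n. (c k l - (\<integral>t. t ^ l \<partial>M k)) * (h k * b' k (n - l))) =
        real n * (h k * b' k n) - (\<Sum>l=1..n. (\<integral>t. t ^ l \<partial>M k) * (h k * b' k (n - l)))" for k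
    proof -
      have "real n * (h k * b' k n) = h k * (\<Sum>l=1..n. c k l * b' k (n - l))"
        unfolding rec[symmetric] by simp
      then show ?thesis
        by (simp add: algebra_simps sum_subtractf sum_distrib_left)
    qed
    ultimately show "(\<lambda>k. real n * (h k * b' k n) - (\<Sum>l=1..n. (\<integral>t. t ^ l \<partial>M k) * (h k * b' k (n - l)))) \<longlonglongrightarrow> 0"
      by simp
  qed
qed

section \<open>Tails of log-concave functions\<close>

definition tail :: "(real \<Rightarrow> real) \<Rightarrow> real \<Rightarrow> real" where
  "tail g y = (\<integral>s. indicator {y..} s * g s \<partial>lborel)"

context
  fixes g :: "real \<Rightarrow> real"
  assumes cont: "continuous_on UNIV g" and pos: "\<And>y. g y > 0"
    and int: "\<And>y. (\<integral>\<^sup>+s. indicator {y..} s * ennreal (g s) \<partial>lborel) < \<infinity>"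
begin

private lemma g_measurable: "g \<in> borel_measurable borel"
  by (rule borel_measurable_continuous_onI[OF cont])

private lemma integrable_atLeast: "integrable lborel (\<lambda>s. indicator {y..} s * g s)"
proof -
  note [measurable] = g_measurable
  have "(\<integral>\<^sup>+s. ennreal (indicator {y..} s * g s) \<partial>lborel) < \<infinity>"
    using int[of y] by (simp add: ennreal_mult' ennreal_indicator)
  then show ?thesis
    by (intro integrableI_nonneg) (use pos in \<open>auto simp: less_imp_le\<close>)
qed

private lemma integrable_atLeastLessThan: "integrable lborel (\<lambda>s. indicator {y..<z} s * g s)"
  using g_measurable by (intro Bochner_Integration.integrable_bound[OF integrable_atLeast[of y]])
    (auto simp: indicator_def)

lemma ennreal_tail: "ennreal (tail g y) = (\<integral>\<^sup>+s. indicator {y..} s * ennreal (g s) \<partial>lborel)"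
proof -
  have "ennreal (tail g y) = (\<integral>\<^sup>+s. ennreal (indicator {y..} s * g s) \<partial>lborel)"
    unfolding tail_def
    by (rule nn_integral_eq_integral[OF integrable_atLeast, symmetric]) (use pos in \<open>auto simp: less_imp_le\<close>)
  then show ?thesis by (simp add: ennreal_mult' ennreal_indicator)
qed

lemma tail_pos: "tail g y > 0"
proof -
  note [measurable] = g_measurable
  have "tail g y \<noteq> 0"
  proof
    assume "tail g y = 0"
    then have "AE s in lborel. indicator {y..} s * g s = 0"
      unfolding tail_def using integrable_atLeast pos
      by (subst (asm) integral_nonneg_eq_0_iff_AE) (auto simp: less_imp_le)
    then have "AE s in lborel. s \<notin> {y..y + 1}"
      by eventually_elim (use pos[THEN less_imp_neq] in \<open>auto simp: indicator_def\<close>)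
    then have "emeasure lborel {y..y + 1} = 0"
      by (subst (asm) AE_iff_measurable[of "{y..y + 1}"]) auto
    then show False by simp
  qed
  moreover have "tail g y \<ge> 0"
    unfolding tail_def using pos by (intro Bochner_Integration.integral_nonneg) (auto simp: less_imp_le)
  ultimately show ?thesis by simp
qed

text \<open>Dominated convergence: a convergent sequence stays above some \<open>- B\<close>, so the
  tail from \<open>- B\<close> dominates, and the integrands converge off the single point
  \<open>s = y\<close>.\<close>

lemma continuous_tail: "continuous_on UNIV (tail g)"
proof -
  note [measurable] = g_measurable
  have "(\<lambda>i. tail g (X i)) \<longlonglongrightarrow> tail g y" if X: "X \<longlonglongrightarrow> y" for X :: "nat \<Rightarrow> real" and y
  proof -
    obtain B where B: "\<And>i. \<bar>X i\<bar> \<le> B"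
      using convergent_imp_Bseq[of X] X by (auto simp: convergent_def Bseq_def)
    have B': "- B \<le> X i" for i using B[of i] by linarith
    show ?thesis
      unfolding tail_def
    proof (rule integral_dominated_convergence[OF _ _ integrable_atLeast[of "- B"]])
      show "AE s in lborel. (\<lambda>i. indicator {X i..} s * g s) \<longlonglongrightarrow> indicator {y..} s * g s"
        using AE_lborel_singleton[of y]
      proof eventually_elim
        case (elim s)
        have "eventually (\<lambda>i. indicator {X i..} s * g s = indicator {y..} s * g s) sequentially"
        proof (cases "s < y")
          case True
          then have "eventually (\<lambda>i. s < X i) sequentially"
            using order_tendstoD(1)[OF X True] by simp
          then show ?thesis by eventually_elim (use True in simp)
        next
          case False
          with elim have "y < s" by simp
          then have "eventually (\<lambda>i. X i < s) sequentially"
            using order_tendstoD(2)[OF X] by simp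
          then show ?thesis by eventually_elim (use False in simp)
        qed
        then show ?case by (rule tendsto_eventually)
      qed
      show "AE s in lborel. norm (indicator {X i..} s * g s) \<le> indicator {- B..} s * g s" for i
        using B'[of i] pos by (auto simp: indicator_def less_imp_le intro: order.trans)
    qed auto
  qed
  then show ?thesis
    by (auto simp: continuous_on_sequentially o_def)
qed

text \<open>With \<open>r = y - x\<close>, log-concavity says that \<open>g (s + r) / g s\<close> decreases in \<open>s\<close>; its value
  \<open>\<lambda>\<close> at \<open>s = x + d\<close> separates the contributions of \<open>[x, x + d]\<close> and \<open>[x + d, \<infinity>)\<close>.\<close>

lemma log_concave_tail:
  assumes lc: "log_concave g"
  shows "log_concave (tail g)"
  unfolding log_concave_def
proof (intro conjI allI impI)
  fix x y d :: real
  assume xy: "x \<le> y" and d: "0 \<le> d"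
  define r where "r = y - x"
  define l where "l = g (x + d + r) / g (x + d)"
  have r: "r \<ge> 0" "y = x + r" using xy by (simp_all add: r_def)
  have l: "l > 0" using pos by (simp add: l_def)
  define D where "D z = (\<integral>s. indicator {z..<z + d} s * g s \<partial>lborel)" for z
  have split: "tail g z = D z + tail g (z + d)" for z
  proof -
    have "tail g z = (\<integral>s. indicator {z..<z + d} s * g s + indicator {z + d..} s * g s \<partial>lborel)"
      unfolding tail_def using d by (intro Bochner_Integration.integral_cong) (auto simp: indicator_def)
    then show ?thesis
      unfolding D_def tail_def
      using Bochner_Integration.integral_add[OF integrable_atLeastLessThan integrable_atLeast] by simp
  qed
  have shift: "(\<integral>s. f s \<partial>lborel) = (\<integral>s. f (s + r) \<partial>lborel)" for f :: "real \<Rightarrow> real"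
    using lborel_integral_real_affine[of 1 f r] by (simp add: add.commute)
  have shift_int: "integrable lborel (\<lambda>s. f (s + r))" if "integrable lborel f" for f :: "real \<Rightarrow> real"
    using lborel_integrable_real_affine[OF that, of 1 r] by (simp add: add.commute)
  have ge: "l * D x \<le> D y"
  proof -
    have "l * D x = (\<integral>s. l * (indicator {x..<x + d} s * g s) \<partial>lborel)"
      by (simp add: D_def)
    also have "\<dots> \<le> (\<integral>s. indicator {y..<y + d} (s + r) * g (s + r) \<partial>lborel)"
    proof (intro integral_mono shift_int integrable_mult_right integrable_atLeastLessThan)
      fix s :: real
      show "l * (indicator {x..<x + d} s * g s) \<le> indicator {y..<y + d} (s + r) * g (s + r)"
      proof (cases "s \<in> {x..<x + d}")
        case True
        have "g s * g (x + d + r) \<le> g (s + r) * g (x + d)"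
          using log_concaveD[OF lc, of s "x + d" r] True r by simp
        then have "l * g s \<le> g (s + r)"
          using pos[of "x + d"] by (simp add: l_def field_simps)
        with True r show ?thesis by (simp add: indicator_def)
      qed (use pos[of "s + r"] in \<open>auto simp: indicator_def less_imp_le\<close>)
    qed
    also have "\<dots> = D y" unfolding D_def by (rule shift[symmetric])
    finally show ?thesis .
  qed
  have le: "tail g (y + d) \<le> l * tail g (x + d)"
  proof -
    have "tail g (y + d) = (\<integral>s. indicator {y + d..} (s + r) * g (s + r) \<partial>lborel)"
      unfolding tail_def by (rule shift)
    also have "\<dots> \<le> (\<integral>s. l * (indicator {x + d..} s * g s) \<partial>lborel)"
    proof (intro integral_mono shift_int integrable_mult_right integrable_atLeast)
      fix s :: real
      show "indicator {y + d..} (s + r) * g (s + r) \<le> l * (indicator {x + d..} s * g s)"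
      proof (cases "s \<ge> x + d")
        case True
        have "g (x + d) * g (s + r) \<le> g (x + d + r) * g s"
          using log_concaveD[OF lc, of "x + d" s r] True r by simp
        then have "g (s + r) \<le> l * g s"
          using pos[of "x + d"] by (simp add: l_def field_simps)
        with True r show ?thesis by (simp add: indicator_def)
      qed (use pos[of s] l r in \<open>auto simp: indicator_def less_imp_le\<close>)
    qed
    finally show ?thesis by (simp add: tail_def)
  qed
  \<comment> \<open>Once both tails are split, \<open>tail g (x + d) * tail g (y + d)\<close> occurs
    on both sides; what remains is
    \<open>D x * tail g (y + d) \<le> D y * tail g (x + d)\<close>.\<close>
  have "D x \<ge> 0"
    unfolding D_def using pos by (intro Bochner_Integration.integral_nonneg) (auto simp: less_imp_le)
  then have "D x * tail g (y + d) \<le> D x * (l * tail g (x + d))"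
    using le by (rule mult_left_mono[rotated])
  also have "\<dots> = l * D x * tail g (x + d)" by simp
  also have "\<dots> \<le> D y * tail g (x + d)"
    using ge tail_pos[of "x + d"] by (intro mult_right_mono) auto
  finally show "tail g x * tail g (y + d) \<le> tail g (x + d) * tail g y"
    unfolding split[of x] split[of y] by (simp add: algebra_simps)
qed (use tail_pos in \<open>auto simp: less_imp_le\<close>)

end

section \<open>Closure properties of log-concavity\<close>

lemma log_concave_mult: "log_concave f \<Longrightarrow> log_concave g \<Longrightarrow> log_concave (\<lambda>y. f y * g y)"
proof -
  assume f: "log_concave f" and g: "log_concave g"
  have "f x * g x * (f (y + d) * g (y + d)) \<le> f (x + d) * g (x + d) * (f y * g y)" if "x \<le> y" "0 \<le> d" for x y d
  proof -
    have "(f x * f (y + d)) * (g x * g (y + d)) \<le> (f (x + d) * f y) * (g (x + d) * g y)"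
      using f g log_concaveD[OF f that] log_concaveD[OF g that]
      by (intro mult_mono[of "f x * f (y + d)"]) (simp_all add: log_concave_def)
    then show ?thesis by (simp add: mult_ac)
  qed
  then show ?thesis using f g by (simp add: log_concave_def)
qed

lemma log_concave_reflect:
  assumes "log_concave f"
  shows "log_concave (\<lambda>y. f (- y))"
proof -
  have "f (- x) * f (- (y + d)) \<le> f (- (x + d)) * f (- y)" if "x \<le> y" "0 \<le> d" for x y d
    using log_concaveD[OF assms, of "- (y + d)" "- x - d" d] that by (simp add: mult.commute)
  then show ?thesis using assms by (simp add: log_concave_def)
qed

text \<open>Clearing denominators reduces the inequality to
  \<open>(exp (- x) - exp (- y)) * (1 - exp (- d)) \<ge> 0\<close>.\<close>

lemma log_concave_logistic: "log_concave logistic"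
  unfolding log_concave_def
proof (intro conjI allI impI)
  fix x y d :: real
  assume "x \<le> y" "0 \<le> d"
  then have "(exp (- x) - exp (- y)) * (1 - exp (- d)) \<ge> 0"
    by (intro mult_nonneg_nonneg) auto
  moreover have "exp (- (z + d)) = exp (- z) * exp (- d)" for z
    by (simp add: exp_add[symmetric])
  ultimately have "(1 + exp (- (x + d))) * (1 + exp (- y)) \<le> (1 + exp (- x)) * (1 + exp (- (y + d)))"
    by (simp only:) (simp add: algebra_simps)
  then have "1 / ((1 + exp (- x)) * (1 + exp (- (y + d)))) \<le> 1 / ((1 + exp (- (x + d))) * (1 + exp (- y)))"
    by (intro divide_left_mono mult_pos_pos exp_add_one_pos) auto
  then show "logistic x * logistic (y + d) \<le> logistic (x + d) * logistic y"
    by (simp add: logistic_def)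
qed (simp add: logistic_pos less_imp_le)

lemma log_concave_one_minus_logistic: "log_concave (\<lambda>y. 1 - logistic y)"
  unfolding one_minus_logistic by (rule log_concave_reflect[OF log_concave_logistic])

text \<open>Under \<open>t = logistic y\<close> the measure \<open>\<phi> dt\<close> becomes \<open>logistic y * (1 - logistic y) * \<phi> dy\<close>,
  so that the numbers \<open>a n\<close> are the moments of a measure on \<open>[0,1]\<close> with density \<open>\<phi>\<close>.\<close>

definition logistic_moments :: "(real \<Rightarrow> real) \<Rightarrow> (nat \<Rightarrow> real) \<Rightarrow> bool" where
  "logistic_moments \<phi> a \<longleftrightarrow> log_concave \<phi> \<and> (\<forall>y. \<phi> y > 0) \<and> continuous_on UNIV \<phi> \<and>
     (\<forall>n. a n \<ge> 0 \<and> (\<integral>\<^sup>+y. ennreal (logistic y ^ Suc n * (1 - logistic y) * \<phi> y) \<partial>lborel) = ennreal (a n))"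

section \<open>Moment integrals in the logistic coordinate\<close>

lemma logistic_tendsto_1: "(logistic \<longlongrightarrow> 1) at_top"
  unfolding logistic_def by real_asymp

lemma DERIV_logistic_power:
  "((\<lambda>y. logistic y ^ Suc n / real (Suc n)) has_real_derivative logistic y ^ Suc n * (1 - logistic y)) (at y)"
  by (rule DERIV_cong[OF DERIV_cdivide[OF DERIV_power[OF DERIV_logistic]]]) simp

text \<open>In the variable \<open>t = logistic y\<close> this is the integral of
  \<open>t ^ n\<close> from \<open>logistic u\<close> to 1.\<close>

lemma nn_integral_logistic_atLeast:
  "(\<integral>\<^sup>+y. ennreal (logistic y ^ Suc n * (1 - logistic y)) * indicator {u..} y \<partial>lborel)
     = ennreal ((1 - logistic u ^ Suc n) / real (Suc n))"
proof -
  have "(\<integral>\<^sup>+y. ennreal (logistic y ^ Suc n * (1 - logistic y)) * indicator {u..} y \<partial>lborel)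
     = ennreal (1 / real (Suc n) - logistic u ^ Suc n / real (Suc n))"
  proof (rule nn_integral_FTC_atLeast)
    show "((\<lambda>y. logistic y ^ Suc n / real (Suc n)) \<longlongrightarrow> 1 / real (Suc n)) at_top"
      using tendsto_divide[OF tendsto_power[OF logistic_tendsto_1, of "Suc n"] tendsto_const, of "real (Suc n)"]
      by (simp del: power_Suc)
    show "0 \<le> logistic x ^ Suc n * (1 - logistic x)" for x
      using logistic_pos[of x] logistic_less_1[of x] by (intro mult_nonneg_nonneg) auto
  qed (use DERIV_logistic_power in \<open>simp_all del: power_Suc\<close>)
  then show ?thesis by (simp only: diff_divide_distrib)
qed

lemma nn_integral_reflect:
  fixes f :: "real \<Rightarrow> ennreal"
  assumes "f \<in> borel_measurable borel"
  shows "(\<integral>\<^sup>+y. f y \<partial>lborel) = (\<integral>\<^sup>+y. f (- y) \<partial>lborel)"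
  using nn_integral_real_affine[OF assms, of "-1" 0] by simp

text \<open>The integral of \<open>t ^ n\<close> from 0 to \<open>logistic u\<close>; reflection
  turns the lower half line into an upper one.\<close>

lemma nn_integral_logistic_atMost:
  "(\<integral>\<^sup>+y. ennreal (logistic y ^ Suc n * (1 - logistic y)) * indicator {..u} y \<partial>lborel)
     = ennreal (logistic u ^ Suc n / real (Suc n))"
proof -
  have "(\<integral>\<^sup>+y. ennreal (logistic y ^ Suc n * (1 - logistic y)) * indicator {..u} y \<partial>lborel)
      = (\<integral>\<^sup>+y. ennreal (logistic (- y) ^ Suc n * (1 - logistic (- y))) * indicator {..u} (- y) \<partial>lborel)"
    by (rule nn_integral_reflect) measurable
  also have "\<dots> = (\<integral>\<^sup>+y. ennreal (logistic (- y) ^ Suc n * (1 - logistic (- y))) * indicator {- u..} y \<partial>lborel)"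
    by (intro nn_integral_cong) (auto simp: indicator_def)
  also have "\<dots> = ennreal (0 - (- (logistic (- (- u)) ^ Suc n / real (Suc n))))"
  proof (rule nn_integral_FTC_atLeast)
    show "((\<lambda>y. - (logistic (- y) ^ Suc n / real (Suc n))) has_real_derivative
        logistic (- x) ^ Suc n * (1 - logistic (- x))) (at x)" for x
      using DERIV_minus[OF DERIV_chain2[OF DERIV_logistic_power DERIV_minus[OF DERIV_ident]], of n x UNIV]
      by (simp del: power_Suc)
    show "((\<lambda>y. - (logistic (- y) ^ Suc n / real (Suc n))) \<longlongrightarrow> 0) at_top"
    proof -
      have "((\<lambda>y. logistic (- y)) \<longlongrightarrow> 0) at_top"
        unfolding logistic_def by real_asymp
      then have "((\<lambda>y. - (logistic (- y) ^ Suc n / real (Suc n))) \<longlongrightarrow> - (0 ^ Suc n / real (Suc n))) at_top"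
        by (intro tendsto_intros of_nat_neq_0)
      then show ?thesis by simp
    qed
    show "0 \<le> logistic (- x) ^ Suc n * (1 - logistic (- x))" for x
      using logistic_pos[of "- x"] logistic_less_1[of "- x"] by (intro mult_nonneg_nonneg) auto
  qed measurable
  finally show ?thesis by simp
qed

text \<open>Lebesgue measure on the unit interval, the case \<open>r = 1\<close>,
  \<open>k 1 = 1\<close>. The overlap of the two half lines is a null set.\<close>

lemma logistic_moments_one: "logistic_moments (\<lambda>_. 1) (\<lambda>n. 1 / real (Suc n))"
proof -
  have "(\<integral>\<^sup>+y. ennreal (logistic y ^ Suc n * (1 - logistic y)) \<partial>lborel) = ennreal (1 / real (Suc n))" for n
  proof -
    let ?f = "\<lambda>y. ennreal (logistic y ^ Suc n * (1 - logistic y))"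
    have "(\<integral>\<^sup>+y. ?f y \<partial>lborel) = (\<integral>\<^sup>+y. ?f y * indicator {0..} y + ?f y * indicator {..0} y \<partial>lborel)"
      by (rule nn_integral_cong_AE)
        (use AE_lborel_singleton[of 0] in eventually_elim, auto simp: indicator_def simp del: power_Suc)
    also have "\<dots> = ennreal ((1 - logistic 0 ^ Suc n) / real (Suc n)) + ennreal (logistic 0 ^ Suc n / real (Suc n))"
      unfolding nn_integral_logistic_atLeast[symmetric] nn_integral_logistic_atMost[symmetric]
      by (rule nn_integral_add) measurable
    also have "\<dots> = ennreal (1 / real (Suc n))"
      using logistic_pos[of 0] logistic_less_1[of 0] power_le_one[of "logistic 0" "Suc n"]
      by (subst ennreal_plus[symmetric]) (auto simp: diff_divide_distrib simp del: power_Suc intro!: divide_nonneg_pos divide_right_mono)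
    finally show ?thesis .
  qed
  then show ?thesis
    unfolding logistic_moments_def log_concave_def by (simp del: power_Suc)
qed

context
  fixes \<phi> :: "real \<Rightarrow> real" and a :: "nat \<Rightarrow> real"
  assumes \<phi>: "logistic_moments \<phi> a"
begin

private lemma lc: "log_concave \<phi>" and pos: "\<phi> y > 0" and cont: "continuous_on UNIV \<phi>"
  and nonneg: "a n \<ge> 0"
  and moment: "(\<integral>\<^sup>+y. ennreal (logistic y ^ Suc n * (1 - logistic y) * \<phi> y) \<partial>lborel) = ennreal (a n)"
  using \<phi> by (auto simp: logistic_moments_def)

private lemma density_measurable: "\<phi> \<in> borel_measurable borel"
  by (rule borel_measurable_continuous_onI[OF cont])

text \<open>As \<open>dt / t\<close> is \<open>(1 - logistic y) dy\<close>, this is the operator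
  integrating \<open>\<phi> t / t\<close> over \<open>u..1\<close>. By Fubini the mass at
  \<open>s\<close> is weighted with the integral of \<open>t ^ n\<close> up to
  \<open>logistic s\<close>, which produces the division by \<open>n + 1\<close>.\<close>

lemma logistic_moments_tail:
  defines "\<psi> \<equiv> tail (\<lambda>y. (1 - logistic y) * \<phi> y)"
  shows "logistic_moments \<psi> (\<lambda>n. a n / real (Suc n))"
proof -
  note [measurable] = density_measurable
  define g where "g y = (1 - logistic y) * \<phi> y" for y
  have g: "continuous_on UNIV g" "log_concave g" "g y > 0" for y
    unfolding g_def using logistic_less_1 pos
    by (auto intro!: continuous_intros cont log_concave_mult log_concave_one_minus_logistic lc)
  have [measurable]: "g \<in> borel_measurable borel"
    by (rule borel_measurable_continuous_onI[OF g(1)])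
  \<comment> \<open>Compared with the zeroth moment the integrand lacks a factor
    \<open>logistic s\<close>, which is at least \<open>logistic y\<close> on the tail.\<close>
  have fin: "(\<integral>\<^sup>+s. indicator {y..} s * ennreal (g s) \<partial>lborel) < \<infinity>" for y
  proof -
    have "(\<integral>\<^sup>+s. indicator {y..} s * ennreal (g s) \<partial>lborel)
        \<le> (\<integral>\<^sup>+s. ennreal (1 / logistic y) * ennreal (logistic s ^ Suc 0 * (1 - logistic s) * \<phi> s) \<partial>lborel)"
    proof (rule nn_integral_mono)
      fix s
      show "indicator {y..} s * ennreal (g s) \<le>
          ennreal (1 / logistic y) * ennreal (logistic s ^ Suc 0 * (1 - logistic s) * \<phi> s)"
      proof (cases "y \<le> s")
        case True
        then have "logistic y \<le> logistic s"
          by (simp add: strict_mono_less_eq[OF logistic_strict_mono])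
        then have "logistic y * g s \<le> logistic s * g s"
          using g(3)[of s] by (simp add: mult_right_mono)
        then have "g s \<le> 1 / logistic y * (logistic s ^ Suc 0 * (1 - logistic s) * \<phi> s)"
          using logistic_pos[of y] by (simp add: g_def field_simps)
        with True show ?thesis
          using logistic_pos[of y] by (simp add: ennreal_mult'[symmetric] ennreal_leI)
      qed simp
    qed
    also have "\<dots> = ennreal (1 / logistic y) * ennreal (a 0)"
      unfolding moment[symmetric] by (rule nn_integral_cmult) measurable
    also have "\<dots> < \<infinity>" by (simp add: ennreal_mult_less_top)
    finally show ?thesis .
  qed
  note T = continuous_tail[OF g(1,3) fin] log_concave_tail[OF g(1,3) fin g(2)] tail_pos[OF g(1,3) fin]
    ennreal_tail[OF g(1,3) fin]
  have \<psi>: "\<psi> = tail g" by (simp add: \<psi>_def g_def[abs_def])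
  have [measurable]: "tail g \<in> borel_measurable borel"
    by (rule borel_measurable_continuous_onI[OF T(1)])
  have "(\<integral>\<^sup>+y. ennreal (logistic y ^ Suc n * (1 - logistic y) * \<psi> y) \<partial>lborel) = ennreal (a n / real (Suc n))" for n
  proof -
    define e where "e y = logistic y ^ Suc n * (1 - logistic y)" for y
    have e: "e y \<ge> 0" for y
      unfolding e_def using logistic_pos[of y] logistic_less_1[of y] by (intro mult_nonneg_nonneg) auto
    have [measurable]: "e \<in> borel_measurable borel" unfolding e_def by measurable
    have "(\<integral>\<^sup>+y. ennreal (e y * \<psi> y) \<partial>lborel)
        = (\<integral>\<^sup>+y. (\<integral>\<^sup>+s. ennreal (e y) * (indicator {y..} s * ennreal (g s)) \<partial>lborel) \<partial>lborel)"
      unfolding \<psi> by (intro nn_integral_cong) (simp add: ennreal_mult' e T(4) nn_integral_cmult)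
    also have "\<dots> = (\<integral>\<^sup>+y. (\<integral>\<^sup>+s. ennreal (g s) * (ennreal (e y) * indicator {..s} y) \<partial>lborel) \<partial>lborel)"
      by (intro nn_integral_cong) (auto simp: indicator_def mult.commute)
    also have "\<dots> = (\<integral>\<^sup>+s. (\<integral>\<^sup>+y. ennreal (g s) * (ennreal (e y) * indicator {..s} y) \<partial>lborel) \<partial>lborel)"
    proof (rule lborel_pair.Fubini')
      \<comment> \<open>Written as a closed half plane, the moving half line is visibly jointly
        measurable.\<close>
      have "(\<lambda>(s, y). ennreal (g s) * (ennreal (e y) * indicator {p. snd p \<le> fst p} (s, y)))
          \<in> borel_measurable (lborel \<Otimes>\<^sub>M lborel)"
        by measurable
      then show "(\<lambda>(s, y). ennreal (g s) * (ennreal (e y) * indicator {..s} y))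
          \<in> borel_measurable (lborel \<Otimes>\<^sub>M lborel)"
        by (rule subst[of _ _ "\<lambda>f. f \<in> borel_measurable (lborel \<Otimes>\<^sub>M lborel)", rotated]) (auto simp: fun_eq_iff indicator_def)
    qed
    also have "\<dots> = (\<integral>\<^sup>+s. ennreal (g s) * ennreal (logistic s ^ Suc n / real (Suc n)) \<partial>lborel)"
      unfolding nn_integral_logistic_atMost[symmetric] e_def[symmetric]
      by (intro nn_integral_cong nn_integral_cmult) measurable
    also have "\<dots> = (\<integral>\<^sup>+s. ennreal (1 / real (Suc n)) * ennreal (logistic s ^ Suc n * (1 - logistic s) * \<phi> s) \<partial>lborel)"
      using g(3) by (intro nn_integral_cong) (simp add: ennreal_mult'[symmetric] g_def less_imp_le mult_ac del: power_Suc)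
    also have "\<dots> = ennreal (1 / real (Suc n)) * ennreal (a n)"
      unfolding moment[symmetric] by (rule nn_integral_cmult) measurable
    finally show ?thesis
      by (simp add: e_def ennreal_mult'[symmetric])
  qed
  then show ?thesis
    using T nonneg unfolding logistic_moments_def \<psi> by (auto simp: mult.assoc)
qed

text \<open>Reflection exchanges \<open>t\<close> and \<open>1 - t\<close>, so the tail becomes the
  integral of \<open>\<phi> t / (1 - t)\<close> over \<open>0..u\<close>. By Fubini the mass at
  \<open>t\<close> receives the factor \<open>(1 - t ^ (n + 1)) / ((n + 1) (1 - t))\<close>, a
  geometric sum; hence the partial sums of moments.\<close>

lemma logistic_moments_reflect_tail:
  defines "\<psi> \<equiv> (\<lambda>y. tail (\<lambda>s. (1 - logistic s) * \<phi> (- s)) (- y))"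
  shows "logistic_moments \<psi> (\<lambda>n. (\<Sum>m\<le>n. a m) / real (Suc n))"
proof -
  note [measurable] = density_measurable
  define g where "g s = (1 - logistic s) * \<phi> (- s)" for s
  have g: "continuous_on UNIV g" "log_concave g" "g y > 0" for y
    unfolding g_def using logistic_less_1 pos
    by (auto intro!: continuous_intros continuous_on_compose2[OF cont] log_concave_mult
        log_concave_one_minus_logistic log_concave_reflect[OF lc])
  have [measurable]: "g \<in> borel_measurable borel"
    by (rule borel_measurable_continuous_onI[OF g(1)])
  \<comment> \<open>The zeroth moment of \<open>\<phi>\<close> in reflected form; up to a factor
    \<open>1 / logistic y\<close> it bounds the tails of \<open>g\<close>.\<close>
  have m0: "(\<integral>\<^sup>+s. ennreal (logistic s * g s) \<partial>lborel) = ennreal (a 0)"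
  proof -
    have "(\<integral>\<^sup>+s. ennreal (logistic s * g s) \<partial>lborel) = (\<integral>\<^sup>+s. ennreal (logistic (- s) * g (- s)) \<partial>lborel)"
      by (rule nn_integral_reflect) measurable
    also have "\<dots> = ennreal (a 0)"
      unfolding moment[symmetric]
      by (intro nn_integral_cong) (simp add: g_def one_minus_logistic[symmetric] mult_ac)
    finally show ?thesis .
  qed
  have fin: "(\<integral>\<^sup>+s. indicator {y..} s * ennreal (g s) \<partial>lborel) < \<infinity>" for y
  proof -
    have "(\<integral>\<^sup>+s. indicator {y..} s * ennreal (g s) \<partial>lborel)
        \<le> (\<integral>\<^sup>+s. ennreal (1 / logistic y) * ennreal (logistic s * g s) \<partial>lborel)"
    proof (rule nn_integral_mono)
      fix s
      show "indicator {y..} s * ennreal (g s) \<le> ennreal (1 / logistic y) * ennreal (logistic s * g s)"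
      proof (cases "y \<le> s")
        case True
        then have "logistic y \<le> logistic s"
          by (simp add: strict_mono_less_eq[OF logistic_strict_mono])
        then have "logistic y * g s \<le> logistic s * g s"
          using g(3)[of s] by (simp add: mult_right_mono)
        then have "g s \<le> 1 / logistic y * (logistic s * g s)"
          using logistic_pos[of y] by (simp add: field_simps)
        with True show ?thesis
          using logistic_pos[of y] by (simp add: ennreal_mult'[symmetric] ennreal_leI)
      qed simp
    qed
    also have "\<dots> = ennreal (1 / logistic y) * ennreal (a 0)"
      unfolding m0[symmetric] by (rule nn_integral_cmult) measurable
    also have "\<dots> < \<infinity>" by (simp add: ennreal_mult_less_top)
    finally show ?thesis .
  qed
  note T = continuous_tail[OF g(1,3) fin] log_concave_tail[OF g(1,3) fin g(2)] tail_pos[OF g(1,3) fin]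
    ennreal_tail[OF g(1,3) fin]
  have \<psi>: "\<psi> = (\<lambda>y. tail g (- y))" by (simp add: \<psi>_def g_def[abs_def])
  have [measurable]: "tail g \<in> borel_measurable borel"
    by (rule borel_measurable_continuous_onI[OF T(1)])
  have "(\<integral>\<^sup>+y. ennreal (logistic y ^ Suc n * (1 - logistic y) * \<psi> y) \<partial>lborel)
      = ennreal ((\<Sum>m\<le>n. a m) / real (Suc n))" for n
  proof -
    define e where "e y = logistic y ^ Suc n * (1 - logistic y)" for y
    have e: "e y \<ge> 0" for y
      unfolding e_def using logistic_pos[of y] logistic_less_1[of y] by (intro mult_nonneg_nonneg) auto
    have [measurable]: "e \<in> borel_measurable borel" unfolding e_def by measurable
    have "(\<integral>\<^sup>+y. ennreal (e y * \<psi> y) \<partial>lborel)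
        = (\<integral>\<^sup>+y. (\<integral>\<^sup>+s. ennreal (e y) * (indicator {- y..} s * ennreal (g s)) \<partial>lborel) \<partial>lborel)"
      unfolding \<psi> by (intro nn_integral_cong) (simp add: ennreal_mult' e T(4) nn_integral_cmult)
    also have "\<dots> = (\<integral>\<^sup>+y. (\<integral>\<^sup>+s. ennreal (g s) * (ennreal (e y) * indicator {- s..} y) \<partial>lborel) \<partial>lborel)"
      by (intro nn_integral_cong) (auto simp: indicator_def mult.commute)
    also have "\<dots> = (\<integral>\<^sup>+s. (\<integral>\<^sup>+y. ennreal (g s) * (ennreal (e y) * indicator {- s..} y) \<partial>lborel) \<partial>lborel)"
    proof (rule lborel_pair.Fubini')
      have "(\<lambda>(s, y). ennreal (g s) * (ennreal (e y) * indicator {p. - fst p \<le> snd p} (s, y)))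
          \<in> borel_measurable (lborel \<Otimes>\<^sub>M lborel)"
        by measurable
      then show "(\<lambda>(s, y). ennreal (g s) * (ennreal (e y) * indicator {- s..} y))
          \<in> borel_measurable (lborel \<Otimes>\<^sub>M lborel)"
        by (rule subst[of _ _ "\<lambda>f. f \<in> borel_measurable (lborel \<Otimes>\<^sub>M lborel)", rotated]) (auto simp: fun_eq_iff indicator_def)
    qed
    also have "\<dots> = (\<integral>\<^sup>+s. ennreal (g s) * ennreal ((1 - logistic (- s) ^ Suc n) / real (Suc n)) \<partial>lborel)"
      unfolding nn_integral_logistic_atLeast[symmetric] e_def[symmetric]
      by (intro nn_integral_cong nn_integral_cmult) measurable
    also have "\<dots> = (\<integral>\<^sup>+s. ennreal (g (- s)) * ennreal ((1 - logistic (- (- s)) ^ Suc n) / real (Suc n)) \<partial>lborel)"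
      by (rule nn_integral_reflect) measurable
    also have "\<dots> = (\<integral>\<^sup>+s. (\<Sum>m\<le>n. ennreal (1 / real (Suc n)) * ennreal (logistic s ^ Suc m * (1 - logistic s) * \<phi> s)) \<partial>lborel)"
    proof (intro nn_integral_cong)
      fix s
      have nn: "0 \<le> logistic s ^ Suc m * (1 - logistic s) * \<phi> s" for m
        using logistic_pos[of s] logistic_less_1[of s] pos[of s] by (intro mult_nonneg_nonneg) auto
      have "g (- s) * ((1 - logistic s ^ Suc n) / real (Suc n))
          = (\<Sum>m\<le>n. 1 / real (Suc n) * (logistic s ^ Suc m * (1 - logistic s) * \<phi> s))"
      proof -
        \<comment> \<open>This lacks the factor \<open>1 - logistic s\<close> of the moment
          integrand; the factorisation of \<open>1 - logistic s ^ Suc n\<close> supplies it.\<close>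
        have "g (- s) = logistic s * \<phi> s" by (simp add: g_def one_minus_logistic)
        moreover have "1 - logistic s ^ Suc n = (1 - logistic s) * (\<Sum>m\<le>n. logistic s ^ m)"
          using one_diff_power_eq[of "logistic s" "Suc n"] by (simp only: lessThan_Suc_atMost)
        ultimately show ?thesis
          by (simp add: sum_distrib_left sum_distrib_right sum_divide_distrib mult_ac)
      qed
      then have "ennreal (g (- s)) * ennreal ((1 - logistic s ^ Suc n) / real (Suc n))
          = ennreal (\<Sum>m\<le>n. 1 / real (Suc n) * (logistic s ^ Suc m * (1 - logistic s) * \<phi> s))"
        using g(3)[of "- s"] by (simp only: ennreal_mult'[symmetric] less_imp_le)
      also have "\<dots> = (\<Sum>m\<le>n. ennreal (1 / real (Suc n) * (logistic s ^ Suc m * (1 - logistic s) * \<phi> s)))"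
        using nn by (intro sum_ennreal[symmetric]) (simp del: power_Suc)
      also have "\<dots> = (\<Sum>m\<le>n. ennreal (1 / real (Suc n)) * ennreal (logistic s ^ Suc m * (1 - logistic s) * \<phi> s))"
        by (intro sum.cong refl ennreal_mult') simp
      finally show "ennreal (g (- s)) * ennreal ((1 - logistic (- (- s)) ^ Suc n) / real (Suc n)) =
         (\<Sum>m\<le>n. ennreal (1 / real (Suc n)) * ennreal (logistic s ^ Suc m * (1 - logistic s) * \<phi> s))"
        by simp
    qed
    also have "\<dots> = (\<Sum>m\<le>n. ennreal (1 / real (Suc n)) * ennreal (a m))"
      unfolding moment[symmetric] by (subst nn_integral_sum) (auto simp: nn_integral_cmult)
    also have "\<dots> = ennreal ((\<Sum>m\<le>n. a m) / real (Suc n))"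
      using nonneg by (simp add: ennreal_mult'[symmetric] sum_ennreal sum_divide_distrib)
    finally show ?thesis
      by (simp add: e_def)
  qed
  moreover have "continuous_on UNIV \<psi>"
    unfolding \<psi> by (intro continuous_on_compose2[OF T(1)] continuous_intros) auto
  moreover have "log_concave \<psi>"
    unfolding \<psi> by (rule log_concave_reflect[OF T(2)])
  ultimately show ?thesis
    using T nonneg unfolding logistic_moments_def by (auto simp: \<psi> sum_nonneg)
qed

text \<open>The bounded-interval result is applied on growing windows; dominated convergence
  recovers each coefficient over the full line.\<close>

lemma moment_recurrent_logistic_moments: "moment_recurrent (\<lambda>n. a (Suc n))"
proof (rule moment_recurrent_limit)
  note [measurable] = density_measurable
  \<comment> \<open>One factor \<open>logistic y\<close> comes from the Jacobian
    \<open>logistic y * (1 - logistic y)\<close>, the other from the shift to \<open>Suc n\<close>.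
    The factor \<open>1 - logistic y\<close> is kept apart for the weights of the partial
    fraction.\<close>
  define p where "p y = logistic y * (logistic y * \<phi> y)" for y
  define I where "I k = {- real (Suc k)..real (Suc k)}" for k
  have p: "log_concave p" "p y > 0" "continuous_on A p" for y A
    unfolding p_def using logistic_pos pos
    by (auto intro!: log_concave_mult log_concave_logistic lc continuous_intros continuous_on_subset[OF cont])
  show "moment_recurrent (\<lambda>n. integral (I k) (\<lambda>y. (1 - logistic y) * p y * logistic y ^ n))" for k
    unfolding I_def by (rule moment_recurrent_interval[OF p]) simp
  fix n
  define f where "f y = (1 - logistic y) * p y * logistic y ^ n" for y
  have f_eq: "f y = logistic y ^ Suc (Suc n) * (1 - logistic y) * \<phi> y" for y
    by (simp add: f_def p_def)
  have f_nonneg: "f y \<ge> 0" for y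
    unfolding f_eq using logistic_pos[of y] logistic_less_1[of y] pos[of y] by (intro mult_nonneg_nonneg) auto
  have [measurable]: "f \<in> borel_measurable borel" unfolding f_eq by measurable
  have nn: "(\<integral>\<^sup>+y. ennreal (f y) \<partial>lborel) = ennreal (a (Suc n))"
    unfolding f_eq by (rule moment)
  have int: "integrable lborel f"
    by (rule integrableI_nonneg) (use f_nonneg nn in auto)
  have val: "(\<integral>y. f y \<partial>lborel) = a (Suc n)"
    by (rule integral_eq_nn_integral[THEN trans]) (use f_nonneg nn nonneg in auto)
  have "(\<lambda>k. \<integral>y. indicator (I k) y * f y \<partial>lborel) \<longlonglongrightarrow> (\<integral>y. f y \<partial>lborel)"
  proof (rule integral_dominated_convergence[OF _ _ int])
    show "AE y in lborel. (\<lambda>k. indicator (I k) y * f y) \<longlonglongrightarrow> f y"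
    proof (rule AE_I2)
      fix y
      obtain k0 where "\<bar>y\<bar> < real k0" using reals_Archimedean2 by blast
      then have "eventually (\<lambda>k. indicator (I k) y * f y = f y) sequentially"
        by (intro eventually_sequentiallyI[of k0]) (auto simp: I_def indicator_def)
      then show "(\<lambda>k. indicator (I k) y * f y) \<longlonglongrightarrow> f y" by (rule tendsto_eventually)
    qed
    show "AE y in lborel. norm (indicator (I k) y * f y) \<le> f y" for k
      using f_nonneg by (intro AE_I2) (auto simp: indicator_def)
  qed (auto simp: I_def)
  moreover have "(\<integral>y. indicator (I k) y * f y \<partial>lborel) = integral (I k) f" for k
  proof -
    have "set_integrable lborel (I k) f"
      unfolding set_integrable_def using int by (intro integrable_mult_indicator) (auto simp: I_def)
    from set_borel_integral_eq_integral(2)[OF this] show ?thesis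
      by (simp add: set_lebesgue_integral_def)
  qed
  ultimately show "(\<lambda>k. integral (I k) (\<lambda>y. (1 - logistic y) * p y * logistic y ^ n)) \<longlonglongrightarrow> a (Suc n)"
    unfolding f_def[symmetric] val by simp
qed

end

section \<open>The coefficients\<close>

definition chains :: "nat \<Rightarrow> nat \<Rightarrow> (nat \<Rightarrow> nat) set" where
  "chains r N = {m \<in> {2..r} \<rightarrow>\<^sub>E {1..N}. \<forall>i\<in>{2..<r}. m (i + 1) \<le> m i}"

lemma chains_le_first:
  assumes "f \<in> chains r N" "i \<in> {2..r}"
  shows "f i \<le> f 2"
proof -
  have "2 \<le> i" "i \<le> r" using assms(2) by auto
  then show ?thesis
  proof (induction i rule: dec_induct)
    case (step i)
    then have "f (Suc i) \<le> f i" using assms(1) by (auto simp: chains_def)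
    with step show ?case by simp
  qed simp
qed

lemma A_fin_chains:
  "A_fin k r n = 1 / real (n + 1) ^ k 1 * (\<Sum>m\<in>chains r (n + 1). 1 / (\<Prod>i\<in>{2..r}. real (m i) ^ k i))"
  by (simp add: A_fin_def chains_def)

lemma finite_chains: "finite (chains r N)"
  unfolding chains_def by (rule finite_subset[OF _ finite_PiE[of "{2..r}" "\<lambda>_. {1..N}"]]) auto

lemma A_fin_1: "A_fin k (Suc 0) n = 1 / real (n + 1) ^ k (Suc 0)"
proof -
  have "chains (Suc 0) (n + 1) = {\<lambda>_. undefined}" by (auto simp: chains_def)
  then show ?thesis by (simp add: A_fin_chains)
qed

text \<open>Fixing the first inner index at \<open>m + 1\<close> leaves chains bounded by
  \<open>m + 1\<close>; their weights together with \<open>1 / (m + 1) ^ k 2\<close> form the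
  coefficient of the shifted sequence.\<close>

lemma A_fin_Suc:
  assumes r: "r \<ge> 1"
  shows "A_fin k (Suc r) n = (\<Sum>m\<le>n. A_fin (\<lambda>i. k (Suc i)) r m) / real (n + 1) ^ k 1"
proof -
  let ?w = "\<lambda>f. 1 / (\<Prod>i\<in>{2..Suc r}. real (f i) ^ k i)"
  let ?w' = "\<lambda>m f. 1 / real (m + 1) ^ k 2 * (1 / (\<Prod>i\<in>{2..r}. real (f i) ^ k (Suc i)))"
  \<comment> \<open>The inverse of \<open>res\<close>: one detaches the entry at position 2 and
    moves the rest down by one place, the other undoes this. \<open>Suc m\<close> occurs because
    entries start at 1 and coefficients at 0.\<close>
  define ext where "ext = (\<lambda>(m, f). \<lambda>i\<in>{2..Suc r}. if i = 2 then Suc m else f (i - 1) :: nat)"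
  define res where "res f = (f 2 - 1, \<lambda>i\<in>{2..r}. f (Suc i))" for f :: "nat \<Rightarrow> nat"
  have "(\<Sum>f\<in>chains (Suc r) (n + 1). ?w f) = (\<Sum>(m, f)\<in>Sigma {..n} (\<lambda>m. chains r (m + 1)). ?w' m f)"
  proof (rule sum.reindex_bij_witness[of _ ext res])
    fix f assume f: "f \<in> chains (Suc r) (n + 1)"
    have f2: "f 2 \<in> {1..n + 1}" using f r by (auto simp: chains_def)
    have "f (Suc i) \<in> {1..f 2}" if "i \<in> {2..r}" for i
    proof -
      have "f (Suc i) \<in> {1..n + 1}" using f that by (auto simp: chains_def)
      moreover have "f (Suc i) \<le> f 2" using chains_le_first[OF f] that by auto
      ultimately show ?thesis by simp
    qed
    then show "res f \<in> Sigma {..n} (\<lambda>m. chains r (m + 1))"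
      using f f2 unfolding res_def chains_def by (auto simp: PiE_def Pi_def)
    show "ext (res f) = f"
    proof
      fix i
      show "ext (res f) i = f i"
      proof (cases "i \<in> {2..Suc r}")
        case True
        show ?thesis
        proof (cases "i = 2")
          case False
          with True have "i - 1 \<in> {2..r}" "Suc (i - 1) = i" by auto
          with True False show ?thesis by (simp add: ext_def res_def)
        qed (use f2 True in \<open>simp add: ext_def res_def\<close>)
      next
        case False
        with f have "f i = undefined" unfolding chains_def PiE_def extensional_def by blast
        with False show ?thesis by (simp add: ext_def res_def del: atLeastAtMost_iff)
      qed
    qed
    have "(\<Prod>i\<in>{2..Suc r}. real (f i) ^ k i) = real (f 2) ^ k 2 * (\<Prod>i\<in>{2..r}. real (f (Suc i)) ^ k (Suc i))"
    proof -
      have "(\<Prod>i\<in>{2..Suc r}. real (f i) ^ k i) = real (f 2) ^ k 2 * (\<Prod>i\<in>{Suc 2..Suc r}. real (f i) ^ k i)"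
        by (rule prod.atLeast_Suc_atMost) (use r in simp)
      then show ?thesis by (simp only: prod.shift_bounds_cl_Suc_ivl)
    qed
    then show "(case res f of (m, f) \<Rightarrow> ?w' m f) = ?w f"
      using f2 by (simp add: res_def)
  next
    fix p assume p: "p \<in> Sigma {..n} (\<lambda>m. chains r (m + 1))"
    then obtain m f where mf: "p = (m, f)" "m \<le> n" "f \<in> chains r (m + 1)" by auto
    have b: "f (i - 1) \<in> {1..m + 1}" if "i \<in> {2..Suc r}" "i \<noteq> 2" for i
    proof -
      have "i - 1 \<in> {2..r}" using that by auto
      with mf(3) show ?thesis unfolding chains_def by (blast dest: PiE_mem)
    qed
    have c: "f i \<le> f (i - 1)" if "i \<in> {2..<Suc r}" "i \<noteq> 2" for i
    proof -
      have "i - 1 \<in> {2..<r}" "i - 1 + 1 = i" using that by auto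
      with mf(3) show ?thesis unfolding chains_def by (metis (no_types, lifting) mem_Collect_eq)
    qed
    show "ext p \<in> chains (Suc r) (n + 1)"
    proof -
      have e: "ext p i = (if i = 2 then Suc m else f (i - 1))" if "i \<in> {2..Suc r}" for i
        using that by (simp add: mf(1) ext_def)
      have "ext p i \<in> {1..n + 1}" if "i \<in> {2..Suc r}" for i
        using b[OF that] mf(2) by (auto simp: e[OF that])
      moreover have "ext p (i + 1) \<le> ext p i" if "i \<in> {2..<Suc r}" for i
        using b[of "i + 1"] c[of i] that e[of i] e[of "i + 1"] by auto
      moreover have "ext p \<in> extensional {2..Suc r}"
        by (simp add: mf(1) ext_def)
      ultimately show ?thesis
        unfolding chains_def PiE_def by blast
    qed
    show "res (ext p) = p"
    proof -
      have "(\<lambda>i\<in>{2..r}. f i) = f"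
        using mf(3) unfolding chains_def by (auto simp: PiE_def extensional_restrict)
      moreover have "(\<lambda>i\<in>{2..r}. ext p (Suc i)) = (\<lambda>i\<in>{2..r}. f i)"
        unfolding mf(1) ext_def by (auto simp: restrict_def fun_eq_iff)
      ultimately show ?thesis
        using r by (simp add: res_def) (simp add: mf(1) ext_def)
    qed
  qed
  also have "\<dots> = (\<Sum>m\<le>n. \<Sum>f\<in>chains r (m + 1). ?w' m f)"
    by (rule sum.Sigma[symmetric]) (auto simp: finite_chains)
  also have "\<dots> = (\<Sum>m\<le>n. A_fin (\<lambda>i. k (Suc i)) r m)"
    unfolding A_fin_chains sum_distrib_left by (simp add: numeral_2_eq_2)
  finally show ?thesis
    by (simp add: A_fin_chains)
qed

lemma logistic_moments_divide_power:
  assumes "logistic_moments \<phi> a"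
  shows "\<exists>\<psi>. logistic_moments \<psi> (\<lambda>n. a n / real (n + 1) ^ j)"
proof (induction j)
  case 0
  then show ?case using assms by auto
next
  case (Suc j)
  then obtain \<psi> where "logistic_moments \<psi> (\<lambda>n. a n / real (n + 1) ^ j)" by blast
  from logistic_moments_tail[OF this] show ?case
    by (auto simp: mult.commute)
qed

text \<open>Since \<open>k 1 > 0\<close>, one factor \<open>1 / (n + 1)\<close> comes with the
  constant density or with the reflected tail; ordinary tails provide the other
  \<open>k 1 - 1\<close>.\<close>

lemma logistic_moments_A_fin:
  assumes "\<And>i. i \<ge> 1 \<Longrightarrow> k i > 0" "r \<ge> 1"
  shows "\<exists>\<phi>. logistic_moments \<phi> (A_fin k r)"
  using assms(2,1)
proof (induction r arbitrary: k rule: dec_induct)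
  case base
  have "A_fin k 1 n = 1 / real (Suc n) / real (n + 1) ^ (k 1 - 1)" for n
    using base[of 1] by (cases "k 1") (auto simp: A_fin_1)
  then show ?case
    using logistic_moments_divide_power[OF logistic_moments_one, of "k 1 - 1"] by (simp add: fun_eq_iff[symmetric])
next
  case (step r)
  obtain \<phi> where \<phi>: "logistic_moments \<phi> (A_fin (\<lambda>i. k (Suc i)) r)"
    using step.IH[of "\<lambda>i. k (Suc i)"] step.prems by auto
  have "A_fin k (Suc r) n = (\<Sum>m\<le>n. A_fin (\<lambda>i. k (Suc i)) r m) / real (Suc n) / real (n + 1) ^ (k 1 - 1)" for n
    using step.prems[of 1] by (cases "k 1") (auto simp: A_fin_Suc[OF step.hyps(1)])
  then have "A_fin k (Suc r) = (\<lambda>n. (\<Sum>m\<le>n. A_fin (\<lambda>i. k (Suc i)) r m) / real (Suc n) / real (n + 1) ^ (k 1 - 1))"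
    by blast
  then show ?case
    using logistic_moments_divide_power[OF logistic_moments_reflect_tail[OF \<phi>], of "k 1 - 1"] by simp
qed

lemma A_fin_nonneg: "A_fin k r n \<ge> 0"
  unfolding A_fin_def by (intro mult_nonneg_nonneg sum_nonneg divide_nonneg_nonneg prod_nonneg) auto

text \<open>For \<open>r = 1\<close> the sum in the recursion contains the coefficient at 0, which
  is 1. The recursion itself is monotone and propagates the inequality.\<close>

lemma A_fin_mono: "r \<ge> 1 \<Longrightarrow> A_fin k r n \<le> A_fin k (Suc r) n"
proof (induction r arbitrary: k n rule: dec_induct)
  case base
  have "A_fin (\<lambda>i. k (Suc i)) (Suc 0) 0 \<le> (\<Sum>m\<le>n. A_fin (\<lambda>i. k (Suc i)) (Suc 0) m)"
    by (rule member_le_sum) (auto simp: A_fin_nonneg)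
  then have "1 \<le> (\<Sum>m\<le>n. A_fin (\<lambda>i. k (Suc i)) (Suc 0) m)"
    by (simp add: A_fin_1[of _ 0])
  then show ?case
    using A_fin_Suc[of 1 k n] by (simp add: A_fin_1[of k] divide_right_mono)
next
  case (step r)
  then show ?case
    by (subst (1 2) A_fin_Suc) (auto intro!: divide_right_mono sum_mono)
qed

text \<open>The recursion divides a sum of \<open>n + 1\<close> numbers, each at most 1, by a power
  that is at least \<open>n + 1\<close>.\<close>

lemma A_fin_le_1:
  assumes "r \<ge> 1" "\<And>i. i \<ge> 1 \<Longrightarrow> k i > 0"
  shows "A_fin k r n \<le> 1"
  using assms
proof (induction r arbitrary: k n rule: dec_induct)
  case base
  then show ?case by (simp add: A_fin_1)
next
  case (step r)
  have "(\<Sum>m\<le>n. A_fin (\<lambda>i. k (Suc i)) r m) \<le> (\<Sum>m\<le>n. 1)"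
    by (intro sum_mono step.IH) (use step.prems in auto)
  also have "\<dots> \<le> real (n + 1) ^ k 1"
    using step.prems[of 1] self_le_power[of "real (n + 1)" "k 1"] by simp
  finally show ?case
    by (simp add: A_fin_Suc[OF step.hyps(1)])
qed

lemma A_fin_tendsto:
  assumes "\<And>i. i \<ge> 1 \<Longrightarrow> k i > 0"
  shows "(\<lambda>r. A_fin k (Suc r) n) \<longlonglongrightarrow> A_inf k n"
proof -
  have "incseq (\<lambda>r. A_fin k (Suc r) n)"
    by (intro incseq_SucI A_fin_mono) simp
  moreover have "\<forall>r. A_fin k (Suc r) n \<le> 1"
    using A_fin_le_1[of _ k n] assms by simp
  ultimately obtain L where L: "(\<lambda>r. A_fin k (Suc r) n) \<longlonglongrightarrow> L"
    by (rule incseq_convergent)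
  then have "(\<lambda>r. A_fin k r n) \<longlonglongrightarrow> L" by (rule LIMSEQ_imp_Suc)
  then have "A_inf k n = L" unfolding A_inf_def by (rule limI)
  with L show ?thesis by simp
qed

lemma A_inf_pos:
  assumes "\<And>i. i \<ge> 1 \<Longrightarrow> k i > 0"
  shows "A_inf k n > 0"
proof -
  have "incseq (\<lambda>r. A_fin k (Suc r) n)"
    by (intro incseq_SucI A_fin_mono) simp
  then have "A_fin k (Suc 0) n \<le> A_inf k n"
    using A_fin_tendsto[OF assms] by (rule incseq_le)
  moreover have "A_fin k (Suc 0) n > 0"
    using A_fin_1[of k n] by simp
  ultimately show ?thesis by simp
qed

lemma moment_recurrent_A_inf:
  assumes "\<And>i. i \<ge> 1 \<Longrightarrow> k i > 0"
  shows "moment_recurrent (\<lambda>n. A_inf k (Suc n))"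
proof (rule moment_recurrent_limit)
  show "moment_recurrent (\<lambda>n. A_fin k (Suc r) (Suc n))" for r
    using logistic_moments_A_fin[of k "Suc r"] assms moment_recurrent_logistic_moments by force
  show "(\<lambda>r. A_fin k (Suc r) (Suc n)) \<longlonglongrightarrow> A_inf k (Suc n)" for n
    by (rule A_fin_tendsto[OF assms])
qed

section \<open>The slit plane\<close>

lemma slit_plane_iff: "z \<in> \<Lambda> \<longleftrightarrow> Im z \<noteq> 0 \<or> Re z < 1"
proof -
  have "z \<in> complex_of_real ` {1..} \<longleftrightarrow> Im z = 0 \<and> Re z \<ge> 1"
    by (auto simp: complex_eq_iff intro!: image_eqI[of _ _ "Re z"])
  then show ?thesis by (auto simp: slit_plane_def)
qed

lemma open_slit_plane: "open \<Lambda>"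
proof -
  have "- \<Lambda> = {z. Im z = 0} \<inter> {z. 1 \<le> Re z}"
    by (auto simp: slit_plane_iff)
  moreover have "closed ({z. Im z = 0} \<inter> {z. 1 \<le> Re z})"
    by (intro closed_Int closed_Collect_eq closed_Collect_le continuous_intros)
  ultimately show ?thesis by (simp add: open_closed)
qed

lemma scale_in_slit_plane:
  assumes "z \<in> \<Lambda>" "t \<in> {0..1}"
  shows "of_real t * z \<in> \<Lambda>"
proof -
  have "t * Re z < 1" if "Re z < 1"
  proof (cases "Re z \<le> 0")
    case True
    then show ?thesis using assms(2) by (smt (verit) atLeastAtMost_iff mult_nonneg_nonpos)
  next
    case False
    then have "t * Re z \<le> 1 * Re z" using assms(2) by (intro mult_right_mono) auto
    with that show ?thesis by simp
  qed
  with assms show ?thesis by (cases "t = 0") (auto simp: slit_plane_iff)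
qed

lemma one_minus_scale_nonzero: "z \<in> \<Lambda> \<Longrightarrow> t \<in> {0..1} \<Longrightarrow> 1 - of_real t * z \<noteq> 0"
proof
  assume "z \<in> \<Lambda>" "t \<in> {0..1}" "1 - of_real t * z = 0"
  then have "1 \<in> \<Lambda>" using scale_in_slit_plane[of z t] by simp
  then show False by (simp add: slit_plane_iff)
qed

lemma zero_in_slit_plane: "0 \<in> \<Lambda>"
  by (simp add: slit_plane_iff)

lemma starlike_slit_plane: "starlike \<Lambda>"
  unfolding starlike_def
proof (intro bexI[OF _ zero_in_slit_plane] ballI subsetI)
  fix z w assume "z \<in> \<Lambda>" "w \<in> closed_segment 0 z"
  then show "w \<in> \<Lambda>"
    using scale_in_slit_plane[of z] by (auto simp: closed_segment_def scaleR_conv_of_real)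
qed

lemma ball_subset_slit_plane: "ball 0 1 \<subseteq> \<Lambda>"
proof
  fix z :: complex assume "z \<in> ball 0 1"
  then have "Re z < 1" using complex_Re_le_cmod[of z] by simp
  then show "z \<in> \<Lambda>" by (simp add: slit_plane_iff)
qed

lemma cis_in_slit_plane: "0 < \<theta> \<Longrightarrow> \<theta> \<le> pi \<Longrightarrow> cis \<theta> \<in> \<Lambda>"
  using sin_gt_zero[of \<theta>] by (cases "\<theta> = pi") (auto simp: slit_plane_iff)

text \<open>Compactness of \<open>{0..1} \<times> cball z r\<close> makes the nonvanishing of the
  denominators uniform; integrability and differentiability of the transform rest on this
  bound.\<close>

lemma one_minus_scale_bounded_below:
  assumes z: "z \<in> \<Lambda>"
  obtains r d where "r > 0" "d > 0" "cball z r \<subseteq> \<Lambda>"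
    "\<And>w t. w \<in> cball z r \<Longrightarrow> t \<in> {0..1} \<Longrightarrow> d \<le> norm (1 - of_real t * w)"
proof -
  obtain r where r: "r > 0" "cball z r \<subseteq> \<Lambda>"
    using z open_slit_plane open_contains_cball by blast
  let ?K = "{0..1::real} \<times> cball z r"
  have "compact ?K" by (intro compact_Times) auto
  moreover have "?K \<noteq> {}" using r by auto
  moreover have "continuous_on ?K (\<lambda>p. norm (1 - of_real (fst p) * snd p))"
    by (intro continuous_intros)
  ultimately obtain p where p: "p \<in> ?K" "\<And>q. q \<in> ?K \<Longrightarrow> norm (1 - of_real (fst p) * snd p) \<le> norm (1 - of_real (fst q) * snd q)"
    using continuous_attains_inf[of ?K "\<lambda>p. norm (1 - of_real (fst p) * snd p)"] by blast
  have "snd p \<in> \<Lambda>" "fst p \<in> {0..1}" using p(1) r(2) by auto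
  then have "norm (1 - of_real (fst p) * snd p) > 0"
    using one_minus_scale_nonzero by simp
  with r p(2) show ?thesis
    by (intro that[of r "norm (1 - of_real (fst p) * snd p)"]) force+
qed

text \<open>With the recurrence measure, the logarithmic derivative of \<open>F z / z\<close>.
  Unlike that of \<open>F\<close> it has no singularity at 0, and its Taylor coefficients are the
  moments of positive order.\<close>

definition stieltjes :: "real measure \<Rightarrow> complex \<Rightarrow> complex" where
  "stieltjes M z = (\<integral>t. of_real t / (1 - of_real t * z) \<partial>M)"

context
  fixes M :: "real measure"
  assumes M: "unit_prob M"
begin

private lemma prob: "prob_space M"
  using M by (simp add: unit_prob_def)

private lemma quotient_integrable:
  assumes "z \<in> \<Lambda>" "\<And>t. t \<in> {0..1} \<Longrightarrow> norm (f t) \<le> 1" "f \<in> borel_measurable borel"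
  shows "integrable M (\<lambda>t. f t / (1 - of_real t * z))"
proof -
  obtain r d where rd: "r > 0" "d > 0"
    "\<And>w t. w \<in> cball z r \<Longrightarrow> t \<in> {0..1} \<Longrightarrow> d \<le> norm (1 - of_real t * w)"
    using one_minus_scale_bounded_below[OF assms(1)] by metis
  show ?thesis
  proof (rule unit_prob_integrable[OF M])
    show "(\<lambda>t. f t / (1 - of_real t * z)) \<in> borel_measurable M"
    proof -
      note [measurable] = assms(3)
      show ?thesis by (intro unit_prob_measurable[OF M]) measurable
    qed
    show "norm (f t / (1 - of_real t * z)) \<le> 1 / d" if "t \<in> {0..1}" for t
      using rd(3)[of z t] rd(1,2) that assms(2)[OF that] by (auto simp: norm_divide intro!: frac_le)
  qed
qed

lemma stieltjes_integrable: "z \<in> \<Lambda> \<Longrightarrow> integrable M (\<lambda>t. of_real t / (1 - of_real t * z))"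
  by (rule quotient_integrable) auto

lemma one_plus_stieltjes:
  assumes "z \<in> \<Lambda>"
  shows "1 + z * stieltjes M z = (\<integral>t. 1 / (1 - of_real t * z) \<partial>M)"
    and "integrable M (\<lambda>t. 1 / (1 - of_real t * z))"
proof -
  interpret prob_space M by (rule prob)
  show "integrable M (\<lambda>t. 1 / (1 - of_real t * z))"
    using assms by (rule quotient_integrable) auto
  have "(\<integral>t. 1 / (1 - of_real t * z) \<partial>M) = (\<integral>t. 1 + z * (of_real t / (1 - of_real t * z)) \<partial>M)"
  proof (rule Bochner_Integration.integral_cong[OF refl])
    fix t assume "t \<in> space M"
    then have "1 - of_real t * z \<noteq> 0"
      using one_minus_scale_nonzero[OF assms] unit_prob_space[OF M] by simp
    then show "1 / (1 - of_real t * z) = 1 + z * (of_real t / (1 - of_real t * z))"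
      by (simp add: field_simps)
  qed
  also have "\<dots> = 1 + z * stieltjes M z"
  proof -
    have "(\<integral>t. 1 + z * (of_real t / (1 - of_real t * z)) \<partial>M)
        = (\<integral>t. 1 \<partial>M) + (\<integral>t. z * (of_real t / (1 - of_real t * z)) \<partial>M)"
      by (rule Bochner_Integration.integral_add)
        (intro integrable_mult_right stieltjes_integrable assms integrable_const)+
    also have "(\<integral>t. z * (of_real t / (1 - of_real t * z)) \<partial>M) = z * stieltjes M z"
      by (simp only: stieltjes_def integral_mult_right_zero)
    finally show ?thesis by (simp add: prob_space)
  qed
  finally show "1 + z * stieltjes M z = (\<integral>t. 1 / (1 - of_real t * z) \<partial>M)" ..
qed

text \<open>The difference quotient at \<open>z\<close> is the integral of the explicit kernel
  \<open>q w\<close>, and \<open>q w - q z\<close> is at most \<open>norm (w - z) / d^3\<close>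
  uniformly in \<open>t\<close>.\<close>

lemma stieltjes_holomorphic: "stieltjes M holomorphic_on \<Lambda>"
proof -
  have "\<exists>D. (stieltjes M has_field_derivative D) (at z)" if z: "z \<in> \<Lambda>" for z
  proof -
    obtain r d where rd: "r > 0" "d > 0" "cball z r \<subseteq> \<Lambda>"
      "\<And>w t. w \<in> cball z r \<Longrightarrow> t \<in> {0..1} \<Longrightarrow> d \<le> norm (1 - of_real t * w)"
      using one_minus_scale_bounded_below[OF z] by metis
    define q where "q w t = (of_real t)\<^sup>2 / ((1 - of_real t * w) * (1 - of_real t * z))" for w :: complex and t :: real
    have q_int: "integrable M (q w)" if w: "w \<in> cball z r" for w
    proof (rule unit_prob_integrable[OF M])
      show "q w \<in> borel_measurable M"
        unfolding q_def by (intro unit_prob_measurable[OF M]) measurable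
      show "norm (q w t) \<le> 1 / (d * d)" if "t \<in> {0..1}" for t
        unfolding q_def norm_divide norm_mult norm_power norm_of_real
        using rd(1,2) rd(4)[OF w that] rd(4)[OF _ that, of z] that
        by (intro frac_le mult_mono) (auto simp: power_le_one)
    qed
    define D where "D = (\<integral>t. q z t \<partial>M)"
    have quot: "(stieltjes M w - stieltjes M z) / (w - z) = (\<integral>t. q w t \<partial>M)" if w: "w \<in> cball z r" "w \<noteq> z" for w
    proof -
      have "w \<in> \<Lambda>" using w rd by auto
      have "stieltjes M w - stieltjes M z = (\<integral>t. of_real t / (1 - of_real t * w) - of_real t / (1 - of_real t * z) \<partial>M)"
        unfolding stieltjes_def
        using stieltjes_integrable[OF \<open>w \<in> \<Lambda>\<close>] stieltjes_integrable[OF z] by simp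
      also have "\<dots> = (\<integral>t. (w - z) * q w t \<partial>M)"
      proof (rule Bochner_Integration.integral_cong[OF refl])
        fix t assume "t \<in> space M"
        then have "1 - of_real t * w \<noteq> 0" "1 - of_real t * z \<noteq> 0"
          using one_minus_scale_nonzero \<open>w \<in> \<Lambda>\<close> z unit_prob_space[OF M] by simp_all
        then show "of_real t / (1 - of_real t * w) - of_real t / (1 - of_real t * z) = (w - z) * q w t"
          by (simp add: q_def field_simps power2_eq_square)
      qed
      finally show ?thesis using w(2) by simp
    qed
    have diff: "norm ((\<integral>t. q w t \<partial>M) - D) \<le> norm (w - z) / (d * d * d)" if w: "w \<in> cball z r" for w
    proof -
      have zr: "z \<in> cball z r" using rd by simp
      have bound: "norm (q w t - q z t) \<le> norm (w - z) / (d * d * d)" if t: "t \<in> {0..1}" for t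
      proof -
        have ne: "1 - of_real t * w \<noteq> 0" "1 - of_real t * z \<noteq> 0"
          using rd(2) rd(4)[OF w t] rd(4)[OF zr t] by auto
        have "q w t - q z t = (of_real t)^3 * (w - z) / ((1 - of_real t * w) * (1 - of_real t * z) * (1 - of_real t * z))"
        proof -
          define X Y T where "X = 1 - of_real t * w" and "Y = 1 - of_real t * z" and "T = complex_of_real t"
          have "X \<noteq> 0" "Y \<noteq> 0" using ne by (simp_all only: X_def Y_def not_False_eq_True)
          then have "T\<^sup>2 / (X * Y) - T\<^sup>2 / (Y * Y) = T\<^sup>2 * (Y - X) / (X * Y * Y)"
            by (simp add: field_simps)
          moreover have "T\<^sup>2 * (Y - X) = T ^ 3 * (w - z)"
            by (simp add: X_def Y_def T_def power2_eq_square power3_eq_cube algebra_simps)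
          ultimately show ?thesis by (simp only: q_def X_def Y_def T_def)
        qed
        also have "norm \<dots> \<le> norm (w - z) / (d * d * d)"
          unfolding norm_divide norm_mult norm_power norm_of_real
          using rd(1,2) rd(4)[OF w t] rd(4)[OF zr t] t
          by (intro frac_le mult_mono mult_left_le_one_le) (auto simp: power_le_one)
        finally show ?thesis .
      qed
      interpret prob_space M by (rule prob)
      have "(\<integral>t. q w t \<partial>M) - D = (\<integral>t. q w t - q z t \<partial>M)"
        unfolding D_def using q_int[OF w] q_int[OF zr] by simp
      also have "norm \<dots> \<le> (\<integral>t. norm (w - z) / (d * d * d) \<partial>M)"
        by (rule Bochner_Integration.integral_norm_bound_integral)
          (use q_int[OF w] q_int[OF zr] bound unit_prob_space[OF M] in auto)
      finally show ?thesis by (simp add: prob_space)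
    qed
    have "((\<lambda>w. (stieltjes M w - stieltjes M z) / (w - z)) \<longlongrightarrow> D) (at z)"
    proof (rule Lim_null_comparison[THEN Lim_null[THEN iffD2]])
      show "((\<lambda>w. norm (w - z) / (d * d * d)) \<longlongrightarrow> 0) (at z)"
        by (rule tendsto_eq_intros refl | use rd(2) in simp)+
      have "eventually (\<lambda>w. w \<in> ball z r - {z}) (at z)"
        using rd(1) by (intro eventually_at_in_open) auto
      then show "\<forall>\<^sub>F w in at z. norm ((stieltjes M w - stieltjes M z) / (w - z) - D) \<le> norm (w - z) / (d * d * d)"
        by eventually_elim (use quot diff in auto)
    qed
    then show ?thesis by (auto simp: has_field_derivative_iff)
  qed
  then show ?thesis
    by (simp add: holomorphic_on_open[OF open_slit_plane])
qed

text \<open>The geometric series is integrated termwise, with \<open>norm z ^ n\<close> as summable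
  majorant.\<close>

lemma stieltjes_has_fps_expansion:
  "stieltjes M has_fps_expansion Abs_fps (\<lambda>n. complex_of_real (\<integral>t. t ^ Suc n \<partial>M))"
proof (rule has_fps_expansionI)
  interpret prob_space M by (rule prob)
  have "(\<lambda>n. complex_of_real (\<integral>t. t ^ Suc n \<partial>M) * z ^ n) sums stieltjes M z" if z: "norm z < 1" for z
  proof -
    define f where "f n t = of_real (t ^ Suc n) * z ^ n" for n and t :: real
    have f_le: "norm (f n t) \<le> norm z ^ n" if "t \<in> {0..1}" for n t
    proof -
      have "\<bar>t\<bar> ^ Suc n \<le> 1" using that by (intro power_le_one) auto
      then show ?thesis
        unfolding f_def norm_mult norm_power norm_of_real power_abs by (intro mult_left_le_one_le) auto
    qed
    have f_int: "integrable M (f n)" for n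
      by (rule unit_prob_integrable[OF M _ f_le])
        (auto simp: f_def intro!: unit_prob_measurable[OF M])
    have "(\<lambda>n. integral\<^sup>L M (f n)) sums (\<integral>t. (\<Sum>n. f n t) \<partial>M)"
    proof (rule sums_integral[OF f_int])
      show "AE t in M. summable (\<lambda>n. norm (f n t))"
      proof (rule AE_I2)
        fix t assume "t \<in> space M"
        then have t: "t \<in> {0..1}" using unit_prob_space[OF M] by simp
        show "summable (\<lambda>n. norm (f n t))"
          by (rule summable_comparison_test'[of "\<lambda>n. norm z ^ n" 0])
            (use z f_le[OF t] in \<open>auto intro: summable_geometric\<close>)
      qed
      show "summable (\<lambda>n. \<integral>t. norm (f n t) \<partial>M)"
      proof (rule summable_comparison_test'[of "\<lambda>n. norm z ^ n" 0])
        fix n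
        have "(\<integral>t. norm (f n t) \<partial>M) \<le> (\<integral>t. norm z ^ n \<partial>M)"
          using f_int f_le unit_prob_space[OF M] by (intro integral_mono) auto
        then show "norm (\<integral>t. norm (f n t) \<partial>M) \<le> norm z ^ n"
          by (simp add: prob_space)
      qed (use z in \<open>auto intro: summable_geometric\<close>)
    qed
    moreover have "(\<integral>t. (\<Sum>n. f n t) \<partial>M) = stieltjes M z"
      unfolding stieltjes_def
    proof (rule Bochner_Integration.integral_cong[OF refl])
      fix t assume "t \<in> space M"
      then have t: "t \<in> {0..1}" using unit_prob_space[OF M] by simp
      have "norm (of_real t * z) \<le> norm z"
        using t by (simp add: norm_mult mult_left_le_one_le)
      then have "(\<lambda>n. of_real t * (of_real t * z) ^ n) sums (of_real t * (1 / (1 - of_real t * z)))"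
        using z by (intro sums_mult geometric_sums) simp
      then have "(\<lambda>n. f n t) sums (of_real t / (1 - of_real t * z))"
        by (simp add: f_def power_mult_distrib mult_ac)
      then show "(\<Sum>n. f n t) = of_real t / (1 - of_real t * z)"
        by (rule sums_unique[symmetric])
    qed
    moreover have "integral\<^sup>L M (f n) = complex_of_real (\<integral>t. t ^ Suc n \<partial>M) * z ^ n" for n
    proof -
      have "integral\<^sup>L M (f n) = (\<integral>t. complex_of_real (t ^ Suc n) \<partial>M) * z ^ n"
        unfolding f_def by (rule integral_mult_left_zero)
      then show ?thesis by (simp only: integral_complex_of_real)
    qed
    ultimately show ?thesis by simp
  qed
  moreover have "eventually (\<lambda>z. z \<in> ball 0 1) (nhds (0::complex))"
    by (rule eventually_nhds_in_open) auto
  ultimately show "\<forall>\<^sub>F z in nhds 0. (\<lambda>n. fps_nth (Abs_fps (\<lambda>n. complex_of_real (\<integral>t. t ^ Suc n \<partial>M))) n * z ^ n) sums stieltjes M z"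
    by (auto elim!: eventually_mono)
qed

text \<open>The kernel has imaginary part \<open>Im z * t / |1 - t s z|^2\<close>, since
  \<open>z * cnj z\<close> is real. This gives the sign of radial derivatives, including their
  vanishing on the real axis.\<close>

lemma Im_mult_stieltjes:
  assumes z: "z \<in> \<Lambda>" and s: "s \<in> {0..1}"
  obtains K where "K \<ge> 0" "Im (z * stieltjes M (of_real s * z)) = Im z * K"
proof -
  define w where "w t = t / (cmod (1 - of_real t * (of_real s * z)))\<^sup>2" for t
  have sz: "of_real s * z \<in> \<Lambda>" by (rule scale_in_slit_plane[OF z s])
  have eq: "Im (z * (of_real t / (1 - of_real t * (of_real s * z)))) = Im z * w t" for t
    by (simp add: Im_divide w_def cmod_power2 algebra_simps)
  have "Im (z * stieltjes M (of_real s * z)) = (\<integral>t. Im (z * (of_real t / (1 - of_real t * (of_real s * z)))) \<partial>M)"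
    unfolding stieltjes_def
    by (subst integral_mult_right_zero[symmetric], rule integral_Im[symmetric])
      (intro integrable_mult_right stieltjes_integrable sz)
  also have "\<dots> = Im z * (\<integral>t. w t \<partial>M)"
    unfolding eq by simp
  finally show ?thesis
    by (rule that[rotated])
      (auto simp: w_def unit_prob_space[OF M] intro!: Bochner_Integration.integral_nonneg)
qed

text \<open>On the unit circle \<open>|1 - t z|^2 = 1 - 2 t Re z + t^2 \<le> 2 (1 - t Re z)\<close>,
  so the kernel has real part at least \<open>1 / 2\<close>.\<close>

lemma Re_one_plus_stieltjes_pos:
  assumes z: "z \<in> \<Lambda>" "norm z = 1"
  shows "Re (1 + z * stieltjes M z) > 0"
proof -
  interpret prob_space M by (rule prob)
  have "(\<integral>t. 1 / 2 \<partial>M) \<le> (\<integral>t. Re (1 / (1 - of_real t * z)) \<partial>M)"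
  proof (rule integral_mono)
    fix t assume "t \<in> space M"
    then have t: "t \<in> {0..1}" using unit_prob_space[OF M] by simp
    have ne: "1 - of_real t * z \<noteq> 0" by (rule one_minus_scale_nonzero[OF z(1) t])
    have "Re z ^ 2 + Im z ^ 2 = 1" using z(2) by (simp add: cmod_power2[symmetric])
    moreover have "(cmod (1 - of_real t * z))\<^sup>2 = (1 - t * Re z)\<^sup>2 + (t * Im z)\<^sup>2"
      by (simp add: cmod_power2)
    moreover have "\<dots> = 1 - 2 * t * Re z + t\<^sup>2 * (Re z ^ 2 + Im z ^ 2)"
      by (simp add: power2_eq_square algebra_simps)
    ultimately have "(cmod (1 - of_real t * z))\<^sup>2 = 1 - 2 * t * Re z + t\<^sup>2"
      by simp
    moreover have "t\<^sup>2 \<le> 1" using t by (simp add: power_le_one)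
    ultimately have "(cmod (1 - of_real t * z))\<^sup>2 \<le> 2 * (1 - t * Re z)" by simp
    moreover have "0 < (cmod (1 - of_real t * z))\<^sup>2" using ne by simp
    ultimately have "1 / 2 \<le> (1 - t * Re z) / (cmod (1 - of_real t * z))\<^sup>2"
      by (intro mult_imp_le_div_pos) simp_all
    also have "\<dots> = Re (1 / (1 - of_real t * z))"
      by (simp add: Re_divide cmod_power2)
    finally show "1 / 2 \<le> Re (1 / (1 - of_real t * z))" .
  qed (use one_plus_stieltjes(2)[OF z(1)] in auto)
  also have "\<dots> = Re (1 + z * stieltjes M z)"
    unfolding one_plus_stieltjes(1)[OF z(1)] by (rule integral_Re[OF one_plus_stieltjes(2)[OF z(1)]])
  finally show ?thesis by (simp add: prob_space)
qed

text \<open>The kernel has imaginary part \<open>t Im z / |1 - t z|^2\<close>, and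
  \<open>|1 - t z| \<le> 2\<close> accounts for the 4. A positive first moment excludes the point
  mass at 0, whose transform is constant.\<close>

lemma Im_one_plus_stieltjes_pos:
  assumes z: "norm z = 1" "Im z > 0" and m: "(\<integral>t. t \<partial>M) > 0"
  shows "Im (1 + z * stieltjes M z) > 0"
proof -
  have z': "z \<in> \<Lambda>" using z by (simp add: slit_plane_iff)
  have "0 < (\<integral>t. t * (Im z / 4) \<partial>M)" using m z by simp
  also have "\<dots> \<le> (\<integral>t. Im (1 / (1 - of_real t * z)) \<partial>M)"
  proof (rule integral_mono)
    show "integrable M (\<lambda>t. t * (Im z / 4))"
      by (intro integrable_mult_left unit_prob_integrable[OF M, of _ 1] unit_prob_measurable[OF M]) auto
    fix t assume "t \<in> space M"
    then have t: "t \<in> {0..1}" using unit_prob_space[OF M] by simp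
    have ne: "1 - of_real t * z \<noteq> 0" by (rule one_minus_scale_nonzero[OF z' t])
    have "cmod (1 - of_real t * z) \<le> norm (1::complex) + norm (of_real t * z)" by (rule norm_triangle_ineq4)
    also have "\<dots> \<le> 2" using t z(1) by (simp add: norm_mult)
    finally have "(cmod (1 - of_real t * z))\<^sup>2 \<le> 2\<^sup>2" by (intro power_mono) auto
    then have "t * Im z / 2\<^sup>2 \<le> t * Im z / (cmod (1 - of_real t * z))\<^sup>2"
      using ne t z(2) by (intro divide_left_mono mult_pos_pos mult_nonneg_nonneg) auto
    also have "\<dots> = Im (1 / (1 - of_real t * z))"
      by (simp add: Im_divide cmod_power2)
    finally show "t * (Im z / 4) \<le> Im (1 / (1 - of_real t * z))" by simp
  qed (use one_plus_stieltjes(2)[OF z'] in auto)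
  also have "\<dots> = Im (1 + z * stieltjes M z)"
    unfolding one_plus_stieltjes(1)[OF z'] by (rule integral_Im[OF one_plus_stieltjes(2)[OF z']])
  finally show ?thesis .
qed

end

text \<open>\<open>G = b 0 * exp E\<close> solves \<open>G' = stieltjes M * G\<close>, so its Taylor
  coefficients obey the recurrence of \<open>b\<close> with the same initial value.\<close>

lemma F_ext_representation:
  assumes k: "\<And>i. i \<ge> 1 \<Longrightarrow> k i > 0"
  obtains M E where "unit_prob M" "(\<integral>t. t \<partial>M) > 0" "E 0 = 0"
    "\<And>z. z \<in> \<Lambda> \<Longrightarrow> (E has_field_derivative stieltjes M z) (at z)"
    "\<And>z. z \<in> \<Lambda> \<Longrightarrow> F_ext k z = of_real (A_inf k (Suc 0)) * z * exp (E z)"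
proof -
  define b where "b n = A_inf k (Suc n)" for n
  have b_pos: "b n > 0" for n
    using A_inf_pos[of k] k by (simp add: b_def)
  obtain M where M: "unit_prob M"
    and rec: "\<And>n. real n * b n = (\<Sum>j=1..n. (\<integral>t. t ^ j \<partial>M) * b (n - j))"
    using moment_recurrent_A_inf[of k] k unfolding moment_recurrent_def b_def[symmetric] by blast
  \<comment> \<open>The case \<open>n = 1\<close> identifies the first moment as
    \<open>b 1 / b 0\<close>; its positivity later yields non-constancy and the strict decrease of
    the modulus.\<close>
  have "(\<integral>t. t \<partial>M) * b 0 = b 1"
    using rec[of 1] by simp
  then have m1: "(\<integral>t. t \<partial>M) > 0"
    using b_pos[of 0] b_pos[of 1] by (metis zero_less_mult_pos2)
  obtain E0 where E0: "\<And>z. z \<in> \<Lambda> \<Longrightarrow> (E0 has_field_derivative stieltjes M z) (at z)"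
    using holomorphic_starlike_primitive[OF holomorphic_on_imp_continuous_on[OF stieltjes_holomorphic[OF M]]
        starlike_slit_plane open_slit_plane, of "{}"]
      holomorphic_on_imp_differentiable_at[OF stieltjes_holomorphic[OF M] open_slit_plane] by auto
  define E where "E z = E0 z - E0 0" for z
  have E: "(E has_field_derivative stieltjes M z) (at z)" if "z \<in> \<Lambda>" for z
    unfolding E_def using DERIV_diff[OF E0[OF that] DERIV_const] by simp
  have E_0: "E 0 = 0" by (simp add: E_def)
  define G where "G z = of_real (b 0) * exp (E z)" for z
  have G: "(G has_field_derivative stieltjes M z * G z) (at z)" if "z \<in> \<Lambda>" for z
    unfolding G_def by (rule derivative_eq_intros E[OF that] refl | simp)+
  then have G_hol: "G holomorphic_on \<Lambda>"
    by (auto simp: holomorphic_on_open[OF open_slit_plane])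
  define \<Gamma> where "\<Gamma> = fps_expansion G 0"
  define S where "S = Abs_fps (\<lambda>n. complex_of_real (\<integral>t. t ^ Suc n \<partial>M))"
  have G_exp: "G has_fps_expansion \<Gamma>"
    unfolding \<Gamma>_def by (rule has_fps_expansion_fps_expansion[OF open_slit_plane zero_in_slit_plane G_hol])
  have "deriv G has_fps_expansion S * \<Gamma>"
  proof (rule has_fps_expansion_cong[THEN iffD1, OF _ refl])
    show "(\<lambda>z. stieltjes M z * G z) has_fps_expansion S * \<Gamma>"
      unfolding S_def by (intro has_fps_expansion_mult stieltjes_has_fps_expansion M G_exp)
    show "\<forall>\<^sub>F z in nhds 0. stieltjes M z * G z = deriv G z"
      using eventually_nhds_in_open[OF open_slit_plane zero_in_slit_plane]
      by eventually_elim (use DERIV_imp_deriv[OF G] in simp)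
  qed
  then have deriv_\<Gamma>: "fps_deriv \<Gamma> = S * \<Gamma>"
    using has_fps_expansion_deriv[OF G_exp] fps_expansion_unique_complex by blast
  have \<Gamma>: "fps_nth \<Gamma> n = of_real (b n)" for n
  proof (induction n rule: less_induct)
    case (less n)
    show ?case
    proof (cases n)
      case 0
      then show ?thesis
        using has_fps_expansion_imp_0_eq_fps_nth_0[OF G_exp] by (simp add: G_def E_0)
    next
      case (Suc m)
      have "of_nat n * fps_nth \<Gamma> n = fps_nth (S * \<Gamma>) m"
        by (simp add: deriv_\<Gamma>[symmetric] Suc)
      also have "\<dots> = (\<Sum>i=0..m. of_real (\<integral>t. t ^ Suc i \<partial>M) * of_real (b (m - i)))"
        unfolding fps_mult_nth S_def using less.IH by (intro sum.cong) (auto simp: Suc)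
      also have "\<dots> = of_real (\<Sum>i=0..m. (\<integral>t. t ^ Suc i \<partial>M) * b (m - i))"
        by simp
      also have "(\<Sum>i=0..m. (\<integral>t. t ^ Suc i \<partial>M) * b (m - i)) = (\<Sum>j=1..n. (\<integral>t. t ^ j \<partial>M) * b (n - j))"
        unfolding Suc by (rule sum.reindex_bij_witness[of _ "\<lambda>j. j - 1" Suc]) auto
      also have "\<dots> = real n * b n" by (rule rec[symmetric])
      finally have "of_nat (Suc m) * fps_nth \<Gamma> n = of_nat (Suc m) * complex_of_real (b n)"
        by (simp only: Suc of_real_mult of_real_of_nat_eq)
      then show ?thesis by (simp only: mult_cancel_left of_nat_neq_0 simp_thms)
    qed
  qed
  define F where "F z = z * G z" for z
  have F_hol: "F holomorphic_on \<Lambda>"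
    unfolding F_def by (intro holomorphic_intros G_hol)
  have F_sums: "(\<lambda>n. complex_of_real (A_inf k (Suc n)) * z ^ Suc n) sums F z" if z: "norm z < 1" for z
  proof -
    have "G holomorphic_on eball 0 1"
      using ball_subset_slit_plane holomorphic_on_subset[OF G_hol] by (simp add: one_ereal_def)
    then have "(\<lambda>n. fps_nth \<Gamma> n * z ^ n) sums G z"
      using z by (intro has_fps_expansion_imp_sums_complex[OF G_exp, where r = 1]) (simp_all add: one_ereal_def)
    from sums_mult[OF this, of z] show ?thesis
      by (simp add: F_def \<Gamma> b_def mult_ac)
  qed
  \<comment> \<open>\<open>F\<close> witnesses that the choice in \<open>F_ext\<close> is not empty;
    the identity theorem on the connected slit plane then equates the chosen function with
    \<open>F\<close>.\<close>
  have F_ext: "F_ext k holomorphic_on \<Lambda> \<and>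
      (\<forall>z. norm z < 1 \<longrightarrow> (\<lambda>n. complex_of_real (A_inf k (Suc n)) * z ^ Suc n) sums F_ext k z)"
    unfolding F_ext_def by (rule someI[of _ F]) (use F_hol F_sums in blast)
  have "F_ext k z = F z" if "z \<in> \<Lambda>" for z
  proof (rule analytic_continuation_open[of "ball 0 1" \<Lambda> "F_ext k" F])
    show "connected \<Lambda>" by (rule starlike_imp_connected[OF starlike_slit_plane])
    show "F_ext k z = F z" if "z \<in> ball 0 1" for z
      using F_ext F_sums[of z] that sums_unique2 by fastforce
  qed (use F_ext F_hol that ball_subset_slit_plane open_slit_plane in auto)
  then have "F_ext k z = of_real (A_inf k (Suc 0)) * z * exp (E z)" if "z \<in> \<Lambda>" for z
    using that by (simp add: F_def G_def b_def)
  with M m1 E_0 E show ?thesis by (rule that)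
qed

theorem proposition4p12:
  fixes k :: "nat \<Rightarrow> nat"
  assumes "\<And>i. i \<ge> 1 \<Longrightarrow> k i > 0"
  shows "P_fun k \<in> \<TT> \<and> \<not> P_fun k constant_on \<Lambda> \<and>
    (\<forall>\<theta>::real. 0 < \<theta> \<and> \<theta> < pi \<longrightarrow>
       (\<exists>D>0. ((\<lambda>t. Arg (F_ext k (cis t))) has_real_derivative D) (at \<theta>)) \<and>
       (\<exists>D<0. ((\<lambda>t. norm (F_ext k (cis t))) has_real_derivative D) (at \<theta>)))"
proof -
  obtain M E where M: "unit_prob M" and m1: "(\<integral>t. t \<partial>M) > 0" and E_0: "E 0 = 0"
    and E: "\<And>z. z \<in> \<Lambda> \<Longrightarrow> (E has_field_derivative stieltjes M z) (at z)"
    and F: "\<And>z. z \<in> \<Lambda> \<Longrightarrow> F_ext k z = of_real (A_inf k (Suc 0)) * z * exp (E z)"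
    using F_ext_representation[of k] assms by metis
  define A where "A = A_inf k (Suc 0)"
  have A: "A > 0" unfolding A_def by (rule A_inf_pos[OF assms])
  define h where "h z = 1 + z * stieltjes M z" for z
  have cont: "isCont (stieltjes M) z" if "z \<in> \<Lambda>" for z
    using stieltjes_holomorphic[OF M] that open_slit_plane
    by (auto simp: continuous_on_eq_continuous_at dest!: holomorphic_on_imp_continuous_on)
  have quotient: "z * deriv (F_ext k) z / F_ext k z = h z" if z: "z \<in> \<Lambda>" "z \<noteq> 0" for z
  proof -
    have "((\<lambda>z. of_real A * z * exp (E z)) has_field_derivative of_real A * exp (E z) * h z) (at z)"
      by (rule derivative_eq_intros E[OF z(1)] refl | simp add: h_def algebra_simps)+
    then have "(F_ext k has_field_derivative of_real A * exp (E z) * h z) (at z)"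
      by (rule has_field_derivative_transform_within_open[OF _ open_slit_plane z(1)])
        (simp add: F A_def)
    then have "deriv (F_ext k) z = of_real A * exp (E z) * h z"
      by (rule DERIV_imp_deriv)
    with A z show ?thesis by (simp add: F A_def[symmetric])
  qed
  have P: "P_fun k z = h z" if z: "z \<in> \<Lambda>" for z
  proof (cases "z = 0")
    case True
    \<comment> \<open>The quotient agrees with \<open>h\<close> near 0 except at 0, so the filled-in
      value is \<open>h 0 = 1\<close>.\<close>
    have "(h \<longlongrightarrow> h 0) (at 0)"
      unfolding h_def by (intro tendsto_intros isContD cont zero_in_slit_plane)
    then have "((\<lambda>w. w * deriv (F_ext k) w / F_ext k w) \<longlongrightarrow> h 0) (at 0)"
      by (rule Lim_transform_within_open[OF _ open_slit_plane zero_in_slit_plane]) (simp add: quotient)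
    then show ?thesis
      using True by (simp add: P_fun_def tendsto_Lim)
  qed (simp add: P_fun_def quotient z)
  have "P_fun k \<in> \<TT>"
    unfolding class_T_def
    using M one_plus_stieltjes(1)[OF M] by (auto simp: P h_def unit_prob_def intro!: exI[of _ M])
  moreover have "\<not> P_fun k constant_on \<Lambda>"
  proof
    assume "P_fun k constant_on \<Lambda>"
    then obtain c where "\<And>z. z \<in> \<Lambda> \<Longrightarrow> h z = c"
      by (auto simp: constant_on_def P)
    \<comment> \<open>\<open>h 0\<close> is real, whereas \<open>h\<close> has positive imaginary
      part at \<open>\<i>\<close>.\<close>
    then have "h (cis (pi / 2)) = h 0"
      using zero_in_slit_plane cis_in_slit_plane[of "pi / 2"] by simp
    then show False
      using Im_one_plus_stieltjes_pos[OF M _ _ m1, of "cis (pi / 2)"] by (simp add: h_def)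
  qed
  moreover have "(\<exists>D>0. ((\<lambda>t. Arg (F_ext k (cis t))) has_real_derivative D) (at \<theta>)) \<and>
       (\<exists>D<0. ((\<lambda>t. norm (F_ext k (cis t))) has_real_derivative D) (at \<theta>))"
    if \<theta>: "0 < \<theta>" "\<theta> < pi" for \<theta>
  proof -
    \<comment> \<open>A smooth logarithm of \<open>F / A\<close> along the unit circle. Its
      derivative is \<open>\<i> * h\<close>, so \<open>Re h\<close> governs the argument and
      \<open>- Im h\<close> the logarithm of the modulus.\<close>
    define L where "L t = \<i> * of_real t + E (cis t)" for t
    have F_cis: "F_ext k (cis t) = of_real A * exp (L t)" if "0 < t" "t \<le> pi" for t
      using F[OF cis_in_slit_plane[OF that]] by (simp add: L_def A_def exp_add cis_conv_exp mult_ac)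
    \<comment> \<open>The end point \<open>pi\<close> is included because the argument is later
      bounded by comparison with its value at \<open>- 1\<close>.\<close>
    have L: "(L has_vector_derivative \<i> * h (cis t)) (at t)" if "0 < t" "t \<le> pi" for t
    proof -
      have "(cis has_vector_derivative \<i> * cis t) (at t)"
        unfolding cis_conv_exp by (rule derivative_eq_intros | simp)+
      then have "((\<lambda>t. E (cis t)) has_vector_derivative \<i> * cis t * stieltjes M (cis t)) (at t)"
        using field_vector_diff_chain_at[of cis "\<i> * cis t" t E "stieltjes M (cis t)"] E[OF cis_in_slit_plane[OF that]]
        by (simp add: o_def)
      moreover have "((\<lambda>t. \<i> * of_real t) has_vector_derivative \<i>) (at t)"
        by (rule derivative_eq_intros refl | simp)+
      ultimately have "(L has_vector_derivative \<i> + \<i> * cis t * stieltjes M (cis t)) (at t)"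
        unfolding L_def by (intro has_vector_derivative_add)
      then show ?thesis by (simp add: h_def algebra_simps)
    qed
    have Im_L: "((\<lambda>t. Im (L t)) has_real_derivative Re (h (cis t))) (at t)"
      and Re_L: "((\<lambda>t. Re (L t)) has_real_derivative - Im (h (cis t))) (at t)" if "0 < t" "t \<le> pi" for t
      using bounded_linear.has_vector_derivative[OF bounded_linear_Im L[OF that]] bounded_linear.has_vector_derivative[OF bounded_linear_Re L[OF that]]
      by (simp_all add: has_real_derivative_iff_has_vector_derivative)
    have Re_h: "Re (h (cis t)) > 0" if "0 < t" "t \<le> pi" for t
      unfolding h_def using cis_in_slit_plane[OF that] by (intro Re_one_plus_stieltjes_pos[OF M]) simp_all
    have radial: "((\<lambda>s. Im (E (of_real s * z))) has_real_derivative Im (z * stieltjes M (of_real s * z))) (at s)"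
      if "z \<in> \<Lambda>" "s \<in> {0..1}" for z s
    proof -
      have "((\<lambda>s. of_real s * z) has_vector_derivative z) (at s)"
        by (rule derivative_eq_intros refl | simp)+
      from field_vector_diff_chain_at[OF this E[OF scale_in_slit_plane[OF that]]]
      have "((\<lambda>s. E (of_real s * z)) has_vector_derivative z * stieltjes M (of_real s * z)) (at s)"
        by (simp add: o_def)
      from bounded_linear.has_vector_derivative[OF bounded_linear_Im this] show ?thesis
        by (simp add: has_real_derivative_iff_has_vector_derivative)
    qed
    \<comment> \<open>Along the segment from 0 to \<open>z\<close> the derivative of
      \<open>Im E\<close> is a nonnegative multiple of \<open>Im z\<close>, and
      \<open>E 0 = 0\<close>.\<close>
    have Im_E_nonneg: "Im (E z) \<ge> 0" if z: "z \<in> \<Lambda>" "Im z \<ge> 0" for z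
    proof -
      have "Im (E (of_real 0 * z)) \<le> Im (E (of_real 1 * z))"
      proof (rule DERIV_nonneg_imp_nondecreasing[where f = "\<lambda>s. Im (E (of_real s * z))"])
        show "\<exists>y. ((\<lambda>s. Im (E (of_real s * z))) has_real_derivative y) (at s) \<and> 0 \<le> y" if "0 \<le> s" "s \<le> 1" for s
          using radial[OF z(1), of s] Im_mult_stieltjes[OF M z(1), of s] that z(2)
          by (metis atLeastAtMost_iff mult_nonneg_nonneg)
      qed simp
      then show ?thesis by (simp add: E_0)
    qed
    \<comment> \<open>On the negative axis the radial derivative vanishes; hence
      \<open>Im (L pi) = pi\<close>.\<close>
    have Im_E_m1: "Im (E (- 1)) = 0"
    proof -
      have m: "- 1 \<in> \<Lambda>" by (simp add: slit_plane_iff)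
      have "Im (E (of_real 1 * (- 1))) \<le> Im (E (of_real 0 * (- 1)))"
      proof (rule DERIV_nonpos_imp_nonincreasing[where f = "\<lambda>s. Im (E (of_real s * (- 1)))"])
        show "\<exists>y. ((\<lambda>s. Im (E (of_real s * (- 1)))) has_real_derivative y) (at s) \<and> y \<le> 0" if "0 \<le> s" "s \<le> 1" for s
        proof -
          have s: "s \<in> {0..1}" using that by simp
          obtain K where "Im (- 1 * stieltjes M (of_real s * (- 1))) = Im (- 1) * K"
            using Im_mult_stieltjes[OF M m s] by metis
          then have "Im (- 1 * stieltjes M (of_real s * (- 1))) = 0" by simp
          with radial[OF m s] show ?thesis by (metis order.refl)
        qed
      qed simp
      with Im_E_nonneg[OF m] show ?thesis by (simp add: E_0)
    qed
    \<comment> \<open>This identifies \<open>Im L\<close> with the principal argument. The lower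
      bound comes from \<open>Im E \<ge> 0\<close>, the upper one from strict growth up to the value
      \<open>pi\<close> at \<open>t = pi\<close>.\<close>
    have Im_L_range: "0 < Im (L t)" "Im (L t) < pi" if t: "0 < t" "t < pi" for t
    proof -
      have "Im (E (cis t)) \<ge> 0"
        using t cis_in_slit_plane[of t] sin_gt_zero[of t] by (intro Im_E_nonneg) auto
      with t show "0 < Im (L t)" by (simp add: L_def)
      have "Im (L t) < Im (L pi)"
      proof (rule DERIV_pos_imp_increasing[OF t(2), where f = "\<lambda>t. Im (L t)"])
        show "\<exists>y. ((\<lambda>t. Im (L t)) has_real_derivative y) (at x) \<and> 0 < y" if "t \<le> x" "x \<le> pi" for x
          using Im_L[of x] Re_h[of x] t that by auto
      qed
      then show "Im (L t) < pi" using Im_E_m1 by (simp add: L_def)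
    qed
    have open_I: "open {0<..<pi}" and \<theta>_I: "\<theta> \<in> {0<..<pi}" using \<theta> by auto
    have "((\<lambda>t. Arg (F_ext k (cis t))) has_real_derivative Re (h (cis \<theta>))) (at \<theta>)"
    proof (rule has_field_derivative_transform_within_open[OF Im_L open_I \<theta>_I])
      show "Im (L t) = Arg (F_ext k (cis t))" if "t \<in> {0<..<pi}" for t
        using that Im_L_range[of t] A by (simp add: F_cis Arg_exp)
    qed (use \<theta> in auto)
    moreover have "((\<lambda>t. norm (F_ext k (cis t))) has_real_derivative A * (exp (Re (L \<theta>)) * - Im (h (cis \<theta>)))) (at \<theta>)"
    proof (rule has_field_derivative_transform_within_open[OF _ open_I \<theta>_I])
      show "((\<lambda>t. A * exp (Re (L t))) has_real_derivative A * (exp (Re (L \<theta>)) * - Im (h (cis \<theta>)))) (at \<theta>)"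
        using \<theta> by (intro DERIV_cmult DERIV_fun_exp Re_L) auto
      show "A * exp (Re (L t)) = norm (F_ext k (cis t))" if "t \<in> {0<..<pi}" for t
        using that A by (simp add: F_cis norm_mult)
    qed
    moreover have "A * (exp (Re (L \<theta>)) * - Im (h (cis \<theta>))) < 0"
    proof -
      have "Im (h (cis \<theta>)) > 0"
        unfolding h_def using \<theta> sin_gt_zero[of \<theta>] by (intro Im_one_plus_stieltjes_pos[OF M _ _ m1]) auto
      with A show ?thesis by (simp add: mult_pos_pos)
    qed
    ultimately show ?thesis using Re_h[of \<theta>] \<theta> by (metis less_imp_le)
  qed
  ultimately show ?thesis by blast
qed

end
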